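(* Let $(X,d,\nu)$ be a compact measured length space. Let $U$ be a continuous convex (real-valued) function on $[0,\infty)$ with $U(0)=0$. Given $\mu\in P_2(X,\nu)$, let $\{\mu_t\}_{t\in[0,1]}$ be a Wasserstein geodesic from $\mu_0=\mu$ to $\mu_1=\nu$. Given $\lambda\in\mathbb{R}$, suppose that for all $t\in[0,1]$, $$U_\nu(\mu_t)\le t\,U_\nu(\mu_1)+(1-t)\,U_\nu(\mu_0)-\frac12\lambda\,t(1-t)W_2(\mu_0,\mu_1)^2.$$ Then $$\frac{\lambda}{2}W_2(\mu,\nu)^2\le U_\nu(\mu)-U_\nu(\nu).$$ Now suppose in addition that $U$ is $C^2$-regular on $(0,\infty)$ and that $\mu\in P_2^{ac}(X,\nu)$ is such that $\rho=\frac{d\mu}{d\nu}$ is a positive Lipschitz function on $X$. Suppose that $U_\nu(\mu)<\infty$ and $\mu_t\in P_2^{ac}(X,\nu)$ for all $t\in[0,1]$. Then $$U_\nu(\mu)-U_\nu(\nu)\le W_2(\mu,\nu)\sqrt{I_U(\mu)}-\frac{\lambda}{2}W_2(\mu,\nu)^2.$$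
   Context: A compact measured length space $(X,d,\nu)$ is a compact length space $(X,d)$ (the distance is the infimum of lengths of joining curves) with a Borel probability measure $\nu$. $P_2(X)$ is the set of Borel probability measures on $X$ with the quadratic Wasserstein metric $W_2(\mu_0,\mu_1)^2=\inf_\pi\int d(x_0,x_1)^2\,d\pi$ ($\pi$ ranging over couplings of $\mu_0,\mu_1$). A Wasserstein geodesic $\{\mu_t\}_{t\in[0,1]}$ is a minimizing geodesic of $P_2(X)$, parametrized so that $W_2(\mu_t,\mu_s)=|t-s|W_2(\mu_0,\mu_1)$. $P_2(X,\nu)=\{\mu\in P_2(X):\mathrm{supp}(\mu)\subset\mathrm{supp}(\nu)\}$, and $P_2^{ac}(X,\nu)$ is the set of its elements absolutely continuous with respect to $\nu$. $U'(\infty)=\lim_{r\to\infty}U(r)/r$ and $U_\nu(\mu)=\int_X U(\rho)\,d\nu+U'(\infty)\mu_s(X)\in\mathbb{R}\cup\{\infty\}$, where $\mu=\rho\nu+\mu_s$ is the Lebesgue decomposition of $\mu$ with respect to $\nu$ (convention $\infty\cdot0=0$). For a function $\rho$ on $X$, $|\nabla^-\rho|(x)=\limsup_{y\to x}\frac{[\rho(x)-\rho(y)]_+}{d(x,y)}$ (with value $0$ at isolated points), where $a_+=\max(a,0)$. For $U$ that is $C^2$ on $(0,\infty)$ and $\mu=\rho\nu$ with $\rho$ positive Lipschitz, $I_U(\mu)=\int_X U''(\rho)^2|\nabla^-\rho|^2\,d\mu=\int_X\rho\,U''(\rho)^2|\nabla^-\rho|^2\,d\nu$. *)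

theory Defs
  imports "HOL-Probability.Probability"
begin

text \<open>
  The space X is a whole type of class metric_space; compactness and the length property are
  hypotheses on its UNIV, and the Borel probability measures on X are the elements of P2 below
  (all of them have finite second moment, since X is compact).
\<close>

section \<open>Length spaces\<close>

text \<open>The supremum runs over finite increasing sequences in [0,1]; adjoining the end points 0 and 1
  only increases the sum.\<close>

definition curve_length :: "(real \<Rightarrow> 'a::metric_space) \<Rightarrow> ennreal" where
  "curve_length g =
     (SUP ts\<in>{ts. sorted ts \<and> set ts \<subseteq> {0..1}}.
        \<Sum>i<length ts - 1. ennreal (dist (g (ts ! i)) (g (ts ! Suc i))))"

definition length_space :: "'a::metric_space set \<Rightarrow> bool" where
  "length_space X \<longleftrightarrow>
     (\<forall>x\<in>X. \<forall>y\<in>X. ennreal (dist x y) =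
        (INF g\<in>{g. path g \<and> path_image g \<subseteq> X \<and> pathstart g = x \<and> pathfinish g = y}.
           curve_length g))"

section \<open>Wasserstein space\<close>

definition P2 :: "'a::metric_space measure set" where
  "P2 = {\<mu>. prob_space \<mu> \<and> sets \<mu> = sets borel}"

definition msupport :: "'a::metric_space measure \<Rightarrow> 'a set" where
  "msupport \<mu> = {x. \<forall>S. open S \<and> x \<in> S \<longrightarrow> 0 < emeasure \<mu> S}"

definition P2_on :: "'a::metric_space measure \<Rightarrow> 'a measure set" where
  "P2_on \<nu> = {\<mu> \<in> P2. msupport \<mu> \<subseteq> msupport \<nu>}"

definition P2_ac :: "'a::metric_space measure \<Rightarrow> 'a measure set" where
  "P2_ac \<nu> = {\<mu> \<in> P2_on \<nu>. absolutely_continuous \<nu> \<mu>}"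

definition couplings ::
  "'a::metric_space measure \<Rightarrow> 'a measure \<Rightarrow> ('a \<times> 'a) measure set" where
  "couplings \<mu> \<nu> = {\<pi>. prob_space \<pi> \<and> sets \<pi> = sets borel \<and>
                       distr \<pi> borel fst = \<mu> \<and> distr \<pi> borel snd = \<nu>}"

definition W2 :: "'a::metric_space measure \<Rightarrow> 'a measure \<Rightarrow> real" where
  "W2 \<mu> \<nu> = sqrt (INF \<pi>\<in>couplings \<mu> \<nu>. \<integral>p. (dist (fst p) (snd p))\<^sup>2 \<partial>\<pi>)"

definition wasserstein_geodesic :: "(real \<Rightarrow> 'a::metric_space measure) \<Rightarrow> bool" where
  "wasserstein_geodesic m \<longleftrightarrow>
     (\<forall>t\<in>{0..1}. m t \<in> P2) \<and>
     (\<forall>s\<in>{0..1}. \<forall>t\<in>{0..1}. W2 (m t) (m s) = \<bar>t - s\<bar> * W2 (m 0) (m 1))"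

section \<open>The functional U_nu\<close>

definition lebesgue_decomposition ::
  "'a::metric_space measure \<Rightarrow> 'a measure \<Rightarrow> ('a \<Rightarrow> real) \<Rightarrow> 'a measure \<Rightarrow> bool" where
  "lebesgue_decomposition \<nu> \<mu> \<rho> \<sigma> \<longleftrightarrow>
     \<rho> \<in> borel_measurable borel \<and> (\<forall>x. 0 \<le> \<rho> x) \<and> sets \<sigma> = sets borel \<and>
     (\<exists>N\<in>sets borel. emeasure \<nu> N = 0 \<and> emeasure \<sigma> (- N) = 0) \<and>
     (\<forall>A\<in>sets borel. emeasure \<mu> A = emeasure (density \<nu> (\<lambda>x. ennreal (\<rho> x))) A + emeasure \<sigma> A)"

text \<open>The Lebesgue decomposition is unique up to modifying the density on a null set of \<open>\<nu>\<close>,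
  which does not change the value of the functional below.\<close>

definition ac_density :: "'a::metric_space measure \<Rightarrow> 'a measure \<Rightarrow> 'a \<Rightarrow> real" where
  "ac_density \<nu> \<mu> = (SOME \<rho>. \<exists>\<sigma>. lebesgue_decomposition \<nu> \<mu> \<rho> \<sigma>)"

definition singular_part :: "'a::metric_space measure \<Rightarrow> 'a measure \<Rightarrow> 'a measure" where
  "singular_part \<nu> \<mu> = (THE \<sigma>. \<exists>\<rho>. lebesgue_decomposition \<nu> \<mu> \<rho> \<sigma>)"

definition slope_at_infinity :: "(real \<Rightarrow> real) \<Rightarrow> ereal" where
  "slope_at_infinity U = Lim at_top (\<lambda>r. ereal (U r / r))"

text \<open>The integral as positive minus negative part. For convex \<open>U\<close> the negative part of
  \<open>U \<circ> \<rho>\<close> is integrable (\<open>U\<close> has an affine minorant on the half-line), so the difference is never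
  of the form \<open>\<infinity> - \<infinity>\<close> or \<open>- \<infinity>\<close>.\<close>

definition ereal_integral :: "'a measure \<Rightarrow> ('a \<Rightarrow> real) \<Rightarrow> ereal" where
  "ereal_integral M f =
     enn2ereal (\<integral>\<^sup>+x. ennreal (f x) \<partial>M) - enn2ereal (\<integral>\<^sup>+x. ennreal (- f x) \<partial>M)"

text \<open>Multiplication on ereal satisfies \<open>\<infinity> * 0 = 0\<close>.\<close>

definition U_functional ::
  "(real \<Rightarrow> real) \<Rightarrow> 'a::metric_space measure \<Rightarrow> 'a measure \<Rightarrow> ereal" where
  "U_functional U \<nu> \<mu> =
     ereal_integral \<nu> (\<lambda>x. U (ac_density \<nu> \<mu> x)) +
     slope_at_infinity U * enn2ereal (emeasure (singular_part \<nu> \<mu>) UNIV)"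

section \<open>The functional I_U\<close>

text \<open>At an isolated point the filter \<open>at x\<close> is trivial and Limsup is the bottom element of
  ennreal, i.e. 0.\<close>

definition descending_slope :: "('a::metric_space \<Rightarrow> real) \<Rightarrow> 'a \<Rightarrow> ennreal" where
  "descending_slope \<rho> x = Limsup (at x) (\<lambda>y. ennreal (max (\<rho> x - \<rho> y) 0 / dist x y))"

text \<open>The value at the measure with density \<open>\<rho>\<close> with respect to \<open>\<nu>\<close>.\<close>

definition I_functional ::
  "(real \<Rightarrow> real) \<Rightarrow> 'a::metric_space measure \<Rightarrow> ('a \<Rightarrow> real) \<Rightarrow> ennreal" where
  "I_functional U \<nu> \<rho> =
     (\<integral>\<^sup>+x. ennreal (\<rho> x * (deriv (deriv U) (\<rho> x))\<^sup>2) * (descending_slope \<rho> x)\<^sup>2 \<partial>\<nu>)"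

definition C2_on_positive :: "(real \<Rightarrow> real) \<Rightarrow> bool" where
  "C2_on_positive U \<longleftrightarrow>
     (\<forall>r>0. U differentiable at r) \<and> (\<forall>r>0. deriv U differentiable at r) \<and>
     continuous_on {0<..} (deriv (deriv U))"

lemma descending_slope_isolated: "at x = bot \<Longrightarrow> descending_slope \<rho> x = 0"
  unfolding descending_slope_def Limsup_def
  by (rule antisym, rule INF_lower2[where i = "\<lambda>_. False"]) (auto simp: bot_ennreal)

text \<open>In the situation of the theorem the functional is finite, so that applying enn2real to it
  loses nothing.\<close>

lemma I_functional_finite:
  fixes \<nu> :: "'a::metric_space measure" and \<rho> :: "'a \<Rightarrow> real"
  assumes "compact (UNIV :: 'a set)" and "prob_space \<nu>"
    and U: "C2_on_positive U"
    and pos: "\<And>x. 0 < \<rho> x" and L: "L-lipschitz_on UNIV \<rho>"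
  shows "I_functional U \<nu> \<rho> < \<infinity>"
proof -
  interpret prob_space \<nu> by fact
  have L0: "0 \<le> L" using L by (rule lipschitz_on_nonneg)
  have cont: "continuous_on UNIV \<rho>"
    using L by (rule lipschitz_on_continuous_on)
  have "continuous_on UNIV (\<lambda>x. \<rho> x * (deriv (deriv U) (\<rho> x))\<^sup>2)"
  proof (intro continuous_intros cont)
    show "continuous_on UNIV (\<lambda>x. deriv (deriv U) (\<rho> x))"
      using U pos unfolding C2_on_positive_def
      by (intro continuous_on_compose2[OF _ cont, of "{0<..}" "deriv (deriv U)"]) auto
  qed
  then have "compact ((\<lambda>x. \<rho> x * (deriv (deriv U) (\<rho> x))\<^sup>2) ` UNIV)"
    using assms(1) by (rule compact_continuous_image)
  then obtain B where B: "\<And>x. \<bar>\<rho> x * (deriv (deriv U) (\<rho> x))\<^sup>2\<bar> \<le> B"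
    using compact_imp_bounded[of "(\<lambda>x. \<rho> x * (deriv (deriv U) (\<rho> x))\<^sup>2) ` UNIV"]
    unfolding bounded_real by blast
  have slope: "descending_slope \<rho> x \<le> ennreal L" for x
    unfolding descending_slope_def
  proof (rule Limsup_bounded)
    show "\<forall>\<^sub>F y in at x. ennreal (max (\<rho> x - \<rho> y) 0 / dist x y) \<le> ennreal L"
    proof (rule eventually_at_filter[THEN iffD2], rule always_eventually, intro allI impI)
      fix y assume "y \<noteq> x"
      then have "0 < dist x y" by auto
      moreover have "\<rho> x - \<rho> y \<le> L * dist x y"
        using lipschitz_onD[OF L, of x y] by (simp add: dist_real_def)
      ultimately show "ennreal (max (\<rho> x - \<rho> y) 0 / dist x y) \<le> ennreal L"
        using L0 by (intro ennreal_leI) (auto simp: divide_simps max_def mult.commute)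
    qed
  qed
  have "I_functional U \<nu> \<rho> \<le> (\<integral>\<^sup>+x. ennreal B * (ennreal L)\<^sup>2 \<partial>\<nu>)"
    unfolding I_functional_def
  proof (rule nn_integral_mono)
    fix x
    show "ennreal (\<rho> x * (deriv (deriv U) (\<rho> x))\<^sup>2) * (descending_slope \<rho> x)\<^sup>2
          \<le> ennreal B * (ennreal L)\<^sup>2"
      using B[of x] slope[of x] by (intro mult_mono power_mono ennreal_leI) simp_all
  qed
  also have "\<dots> < \<infinity>"
    by (simp add: emeasure_space_1 ennreal_mult_less_top power_less_top_ennreal)
  finally show ?thesis .
qed

end

theory Submission
  imports Defs
begin

text \<open>
  By Jensen's inequality \<open>U\<^sub>\<nu>\<close> is minimal at \<open>\<nu>\<close>, so the convexity estimate along the geodesic, divided by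
  \<open>1 - t\<close>, gives the first inequality as \<open>t \<rightarrow> 1\<close>. For the second, put \<open>h = U' \<circ> \<rho>\<close>. The tangent
  inequality for \<open>U\<close> bounds \<open>U\<^sub>\<nu>(\<mu>) - U\<^sub>\<nu>(\<mu>\<^sub>t)\<close> by the integral of \<open>h(x) - h(y)\<close> against any coupling of
  \<open>\<mu>\<close> and \<open>\<mu>\<^sub>t\<close>, hence by \<open>t W\<^sub>2(\<mu>,\<nu>)\<close> times the \<open>L\<^sup>2(\<mu>)\<close> norm of the local slope of \<open>h\<close> at scale \<open>r\<close>,
  up to an error that is \<open>o(t)\<close> for fixed \<open>r\<close>. Let \<open>t \<rightarrow> 0\<close>, then \<open>r \<rightarrow> 0\<close>, and use that the descending slope of
  \<open>h\<close> is at most \<open>U''(\<rho>)\<close> times that of \<open>\<rho>\<close>.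
\<close>

section \<open>The Lebesgue decomposition\<close>

lemma P2_space: "\<mu> \<in> P2 \<Longrightarrow> space \<mu> = UNIV"
  unfolding P2_def by (metis (mono_tags, lifting) mem_Collect_eq sets_eq_imp_space_eq space_borel)

text \<open>Exhaustion: a \<nu>-null set \<open>N\<close> of maximal \<mu>-measure collects all the
  singular mass. The restriction of \<mu> to \<open>- N\<close> is then absolutely continuous and
  gets its density from Radon-Nikodym; the restriction to \<open>N\<close> is the singular
  part.\<close>

lemma lebesgue_decomposition_exists:
  fixes \<nu> \<mu> :: "'a::metric_space measure"
  assumes "finite_measure \<nu>" and "finite_measure \<mu>"
    and sets: "sets \<nu> = sets borel" "sets \<mu> = sets borel"
  shows "\<exists>\<rho> \<sigma>. lebesgue_decomposition \<nu> \<mu> \<rho> \<sigma>"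
proof -
  interpret nu: finite_measure \<nu> by fact
  interpret mu: finite_measure \<mu> by fact
  let ?Z = "null_sets \<nu>"
  have "?Z \<noteq> {}" by blast
  \<comment> \<open>The supremum is approached along countably many null sets, so their union, again
    null, attains it.\<close>
  from ennreal_SUP_countable_SUP[OF this, of "emeasure \<mu>"]
  obtain a where "range a \<subseteq> emeasure \<mu> ` ?Z" and a: "(SUP A\<in>?Z. emeasure \<mu> A) = (SUP i::nat. a i)"
    by auto
  then have "\<forall>i. \<exists>A. a i = emeasure \<mu> A \<and> A \<in> ?Z" by auto
  from choice[OF this] obtain A where A: "\<And>i. a i = emeasure \<mu> (A i)" "\<And>i. A i \<in> ?Z" by blast
  define N where "N = (\<Union>i. A i)"
  have N: "N \<in> ?Z" unfolding N_def using A by auto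
  have max: "emeasure \<mu> B \<le> emeasure \<mu> N" if "B \<in> ?Z" for B
  proof -
    have "emeasure \<mu> B \<le> (SUP i. emeasure \<mu> (A i))"
      using that a unfolding A(1) by (metis SUP_upper)
    also have "\<dots> \<le> emeasure \<mu> N"
      using N sets by (intro SUP_least emeasure_mono) (auto simp: N_def null_sets_def)
    finally show ?thesis .
  qed
  have Nb: "N \<in> sets borel" "N \<in> sets \<mu>" "N \<in> sets \<nu>" using N sets by (auto simp: null_sets_def)
  define \<tau> where "\<tau> = density \<mu> (indicator (- N))"
  define \<sigma> where "\<sigma> = density \<mu> (indicator N)"
  have [simp]: "sets \<tau> = sets borel" "sets \<sigma> = sets borel" using sets by (simp_all add: \<tau>_def \<sigma>_def)
  have em: "emeasure \<tau> B = emeasure \<mu> (B - N)" "emeasure \<sigma> B = emeasure \<mu> (B \<inter> N)"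
    if "B \<in> sets borel" for B
  proof -
    have "- N \<in> sets \<mu>" using Nb sets by auto
    then show "emeasure \<tau> B = emeasure \<mu> (B - N)" "emeasure \<sigma> B = emeasure \<mu> (B \<inter> N)"
      using that Nb sets unfolding \<tau>_def \<sigma>_def
      by (auto simp: emeasure_density ac_simps nn_integral_indicator Diff_eq
          simp flip: indicator_inter_arith)
  qed
  have ac: "absolutely_continuous \<nu> \<tau>"
    unfolding absolutely_continuous_def
  proof
    fix B assume B: "B \<in> ?Z"
    then have Bb: "B \<in> sets borel" using sets by (auto simp: null_sets_def)
    \<comment> \<open>A positive mass of \<open>B - N\<close> would push the null set
      \<open>N \<union> (B - N)\<close> above the maximum; finiteness of \<mu> permits the
      cancellation.\<close>
    have "emeasure \<mu> N + emeasure \<mu> (B - N) = emeasure \<mu> (N \<union> (B - N))"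
      using Bb Nb sets by (intro plus_emeasure) auto
    also have "\<dots> \<le> emeasure \<mu> N + 0"
      using max[of "N \<union> (B - N)"] B N by (simp add: null_sets.Un)
    finally have "emeasure \<mu> (B - N) = 0"
      using mu.emeasure_finite[of N] by (simp add: ennreal_add_left_cancel_le)
    then show "B \<in> null_sets \<tau>" using em Bb by (auto simp: null_sets_def)
  qed
  have "finite_measure \<tau>"
    using em[of UNIV] by (intro finite_measureI) (simp add: \<tau>_def sets_eq_imp_space_eq[OF sets(2)])
  then obtain D where D: "D \<in> borel_measurable \<nu>" "AE x in \<nu>. RN_deriv \<nu> \<tau> x = ennreal (D x)"
      "\<And>x. 0 \<le> D x"
    using nu.real_RN_deriv[of \<tau>] ac sets(1) \<open>sets \<tau> = sets borel\<close> by metis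
  have Db: "D \<in> borel_measurable borel" using D(1) sets(1) by (simp cong: measurable_cong_sets)
  have dens: "density \<nu> (\<lambda>x. ennreal (D x)) = \<tau>"
  proof -
    have "density \<nu> (\<lambda>x. ennreal (D x)) = density \<nu> (RN_deriv \<nu> \<tau>)"
    proof (rule density_cong)
      show "AE x in \<nu>. ennreal (D x) = RN_deriv \<nu> \<tau> x"
        using D(2) by (rule eventually_mono) simp
    qed (use D in auto)
    also have "\<dots> = \<tau>"
      using sets(1) \<open>sets \<tau> = sets borel\<close> by (intro nu.density_RN_deriv[OF ac]) metis
    finally show ?thesis .
  qed
  have "lebesgue_decomposition \<nu> \<mu> D \<sigma>"
    unfolding lebesgue_decomposition_def dens
  proof (intro conjI ballI bexI[of _ N])
    show "emeasure \<sigma> (- N) = 0" using em(2)[of "- N"] Nb by simp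
    fix B :: "'a set" assume B: "B \<in> sets borel"
    have "emeasure \<mu> (B - N) + emeasure \<mu> (B \<inter> N) = emeasure \<mu> ((B - N) \<union> (B \<inter> N))"
      using B Nb sets by (intro plus_emeasure) auto
    then show "emeasure \<mu> B = emeasure \<tau> B + emeasure \<sigma> B"
      using em[OF B] by (simp add: Un_Diff_Int)
  qed (use D Db Nb N in \<open>auto simp: null_sets_def\<close>)
  then show ?thesis by blast
qed

text \<open>The absolutely continuous part vanishes on \<open>N\<close> and the singular part off
  \<open>N\<close>. Any admissible \<open>N\<close> is allowed, so that two decompositions can be
  compared on a common null set.\<close>

lemma lebesgue_decomposition_singular_eq:
  assumes "lebesgue_decomposition \<nu> \<mu> \<rho> \<sigma>" "sets \<nu> = sets borel"
    and N: "N \<in> sets borel" "emeasure \<nu> N = 0" "emeasure \<sigma> (- N) = 0"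
    and B: "B \<in> sets borel"
  shows "emeasure \<sigma> B = emeasure \<mu> (B \<inter> N)"
proof -
  have \<rho>: "\<rho> \<in> borel_measurable borel" and ss: "sets \<sigma> = sets borel"
    and eq: "\<And>A. A \<in> sets borel \<Longrightarrow>
      emeasure \<mu> A = emeasure (density \<nu> (\<lambda>x. ennreal (\<rho> x))) A + emeasure \<sigma> A"
    using assms(1) by (auto simp: lebesgue_decomposition_def)
  have "\<rho> \<in> borel_measurable \<nu>" using \<rho> assms(2) by (simp cong: measurable_cong_sets)
  moreover have "B \<inter> N \<in> null_sets \<nu>"
    using N B assms(2) by (intro null_set_Int1) (auto simp: null_sets_def)
  ultimately have "emeasure (density \<nu> (\<lambda>x. ennreal (\<rho> x))) (B \<inter> N) = 0"
    using absolutely_continuousI_density[of "\<lambda>x. ennreal (\<rho> x)" \<nu>]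
    by (auto simp: absolutely_continuous_def null_sets_def)
  then have "emeasure \<mu> (B \<inter> N) = emeasure \<sigma> (B \<inter> N)"
    using eq[of "B \<inter> N"] B N by auto
  moreover have "emeasure \<sigma> (B \<inter> N) = emeasure \<sigma> B"
  proof -
    have "emeasure \<sigma> (B - N) = 0"
      using N ss emeasure_eq_0[of "- N" \<sigma> "B - N"] by auto
    moreover have "emeasure \<sigma> (B \<inter> N) + emeasure \<sigma> (B - N) = emeasure \<sigma> ((B \<inter> N) \<union> (B - N))"
      using B N ss by (intro plus_emeasure) auto
    ultimately show ?thesis by (simp add: Int_Diff_Un)
  qed
  ultimately show ?thesis by metis
qed

lemma lebesgue_decomposition_unique_singular:
  assumes "lebesgue_decomposition \<nu> \<mu> \<rho> \<sigma>" "lebesgue_decomposition \<nu> \<mu> \<rho>' \<sigma>'"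
    and sets: "sets \<nu> = sets borel"
  shows "\<sigma> = \<sigma>'"
proof -
  obtain N where N: "N \<in> sets borel" "emeasure \<nu> N = 0" "emeasure \<sigma> (- N) = 0"
    and s: "sets \<sigma> = sets borel"
    using assms(1) by (auto simp: lebesgue_decomposition_def)
  obtain N' where N': "N' \<in> sets borel" "emeasure \<nu> N' = 0" "emeasure \<sigma>' (- N') = 0"
    and s': "sets \<sigma>' = sets borel"
    using assms(2) by (auto simp: lebesgue_decomposition_def)
  \<comment> \<open>Both singular parts are carried by the union of the two null sets, hence both
    are the restriction of \<mu> to it.\<close>
  have U: "N \<union> N' \<in> sets borel" "emeasure \<nu> (N \<union> N') = 0"
    using N N' sets emeasure_Un_null_set[of N \<nu> N'] by (auto simp: null_sets_def)
  have "emeasure \<sigma> (- (N \<union> N')) = 0" "emeasure \<sigma>' (- (N \<union> N')) = 0"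
    using N N' s s' emeasure_eq_0[of "- N" \<sigma> "- (N \<union> N')"] emeasure_eq_0[of "- N'" \<sigma>' "- (N \<union> N')"]
    by auto
  with U show ?thesis
    using lebesgue_decomposition_singular_eq[OF assms(1) sets, of "N \<union> N'"]
      lebesgue_decomposition_singular_eq[OF assms(2) sets, of "N \<union> N'"] s s'
    by (intro measure_eqI) auto
qed

text \<open>\<open>ac_density\<close> and \<open>singular_part\<close> are chosen independently of
  each other; uniqueness of the singular part makes them belong to one decomposition.\<close>

lemma lebesgue_decomposition_ac_density:
  fixes \<nu> \<mu> :: "'a::metric_space measure"
  assumes "prob_space \<nu>" and "prob_space \<mu>" and "sets \<nu> = sets borel" "sets \<mu> = sets borel"
  shows "lebesgue_decomposition \<nu> \<mu> (ac_density \<nu> \<mu>) (singular_part \<nu> \<mu>)"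
proof -
  have "\<exists>\<rho>. \<exists>\<sigma>. lebesgue_decomposition \<nu> \<mu> \<rho> \<sigma>"
    using lebesgue_decomposition_exists[of \<nu> \<mu>] assms by (auto simp: prob_space_def)
  from someI_ex[OF this] obtain \<sigma> where \<sigma>: "lebesgue_decomposition \<nu> \<mu> (ac_density \<nu> \<mu>) \<sigma>"
    unfolding ac_density_def by blast
  have "singular_part \<nu> \<mu> = \<sigma>"
    unfolding singular_part_def
  proof (rule the_equality)
    show "\<exists>\<rho>. lebesgue_decomposition \<nu> \<mu> \<rho> \<sigma>" using \<sigma> by blast
    show "\<tau> = \<sigma>" if "\<exists>\<rho>. lebesgue_decomposition \<nu> \<mu> \<rho> \<tau>" for \<tau>
      using that lebesgue_decomposition_unique_singular[OF _ \<sigma> assms(3)] by blast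
  qed
  with \<sigma> show ?thesis by simp
qed

text \<open>The singular part is the restriction of \<mu> to a \<nu>-null set, which absolute
  continuity makes \<mu>-null as well.\<close>

lemma absolutely_continuous_singular_part:
  fixes \<nu> \<mu> :: "'a::metric_space measure"
  assumes "prob_space \<nu>" and "prob_space \<mu>" and sets: "sets \<nu> = sets borel" "sets \<mu> = sets borel"
    and "absolutely_continuous \<nu> \<mu>"
  shows "emeasure (singular_part \<nu> \<mu>) UNIV = 0"
    and "density \<nu> (\<lambda>x. ennreal (ac_density \<nu> \<mu> x)) = \<mu>"
proof -
  note L = lebesgue_decomposition_ac_density[OF assms(1-4)]
  then obtain N where N: "N \<in> sets borel" "emeasure \<nu> N = 0" "emeasure (singular_part \<nu> \<mu>) (- N) = 0"
    by (auto simp: lebesgue_decomposition_def)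
  have "emeasure \<mu> N = 0"
    using N assms(5) sets by (auto simp: absolutely_continuous_def null_sets_def)
  then show *: "emeasure (singular_part \<nu> \<mu>) UNIV = 0"
    using lebesgue_decomposition_singular_eq[OF L sets(1) N] by simp
  have s: "sets (singular_part \<nu> \<mu>) = sets borel" using L by (auto simp: lebesgue_decomposition_def)
  show "density \<nu> (\<lambda>x. ennreal (ac_density \<nu> \<mu> x)) = \<mu>"
  proof (rule measure_eqI)
    fix A assume "A \<in> sets (density \<nu> (\<lambda>x. ennreal (ac_density \<nu> \<mu> x)))"
    then have A: "A \<in> sets borel" using sets by simp
    have "emeasure (singular_part \<nu> \<mu>) A = 0"
      using * s emeasure_eq_0[of UNIV "singular_part \<nu> \<mu>" A] by auto
    then show "emeasure (density \<nu> (\<lambda>x. ennreal (ac_density \<nu> \<mu> x))) A = emeasure \<mu> A"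
      using L A by (simp add: lebesgue_decomposition_def)
  qed (use sets in simp)
qed

section \<open>Integrals with extended real values\<close>

lemma ereal_integral_eq:
  assumes "integrable M f"
  shows "ereal_integral M f = ereal (\<integral>x. f x \<partial>M)"
proof -
  have "(\<integral>\<^sup>+x. ennreal (f x) \<partial>M) \<noteq> \<top>" "(\<integral>\<^sup>+x. ennreal (- f x) \<partial>M) \<noteq> \<top>"
    using integrableD(2,3)[OF assms] by auto
  then have "enn2ereal (\<integral>\<^sup>+x. ennreal (f x) \<partial>M) = ereal (enn2real (\<integral>\<^sup>+x. ennreal (f x) \<partial>M))"
    "enn2ereal (\<integral>\<^sup>+x. ennreal (- f x) \<partial>M) = ereal (enn2real (\<integral>\<^sup>+x. ennreal (- f x) \<partial>M))"
    by (metis enn2ereal_ennreal enn2real_nonneg ennreal_enn2real top.not_eq_extremum)+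
  then show ?thesis
    using assms unfolding ereal_integral_def by (simp add: real_lebesgue_integral_def)
qed

text \<open>Used where the larger integral may be infinite: positive and negative parts are compared
  separately, and subtraction on \<open>ereal\<close> is monotone at infinite values too.\<close>

lemma ereal_integral_mono:
  assumes "AE x in M. g x \<le> f x"
  shows "ereal_integral M g \<le> ereal_integral M f"
proof -
  have "(\<integral>\<^sup>+x. ennreal (g x) \<partial>M) \<le> (\<integral>\<^sup>+x. ennreal (f x) \<partial>M)"
    using assms by (intro nn_integral_mono_AE) (auto elim!: eventually_mono intro: ennreal_leI)
  moreover have "(\<integral>\<^sup>+x. ennreal (- f x) \<partial>M) \<le> (\<integral>\<^sup>+x. ennreal (- g x) \<partial>M)"
    using assms by (intro nn_integral_mono_AE) (auto elim!: eventually_mono intro: ennreal_leI)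
  ultimately show ?thesis
    unfolding ereal_integral_def less_eq_ennreal.rep_eq by (rule ereal_minus_mono)
qed

lemma ereal_integral_cong_AE:
  assumes "AE x in M. f x = g x"
  shows "ereal_integral M f = ereal_integral M g"
proof (rule antisym)
  show "ereal_integral M f \<le> ereal_integral M g"
    using assms by (intro ereal_integral_mono) auto
  show "ereal_integral M g \<le> ereal_integral M f"
    using assms by (intro ereal_integral_mono) auto
qed

section \<open>Lower bounds for the functional\<close>

text \<open>A density is unique almost everywhere, so the arbitrarily chosen
  \<open>ac_density\<close> may be replaced by any given one.\<close>

lemma U_functional_density:
  fixes \<nu> \<mu> :: "'a::metric_space measure"
  assumes "prob_space \<nu>" and "prob_space \<mu>" and sets: "sets \<nu> = sets borel"
    and \<mu>: "\<mu> = density \<nu> (\<lambda>x. ennreal (\<rho> x))"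
    and \<rho>: "\<rho> \<in> borel_measurable borel" "\<And>x. 0 \<le> \<rho> x"
  shows "U_functional U \<nu> \<mu> = ereal_integral \<nu> (\<lambda>x. U (\<rho> x))"
proof -
  interpret prob_space \<nu> by fact
  have s': "sets \<mu> = sets borel" using sets \<mu> by simp
  have m: "\<rho> \<in> borel_measurable \<nu>" using \<rho> sets by (simp cong: measurable_cong_sets)
  have ac: "absolutely_continuous \<nu> \<mu>"
    unfolding \<mu> using m by (intro absolutely_continuousI_density) simp
  note sing = absolutely_continuous_singular_part[OF assms(1,2) sets s' ac]
  have D: "ac_density \<nu> \<mu> \<in> borel_measurable \<nu>" "\<And>x. 0 \<le> ac_density \<nu> \<mu> x"
    using lebesgue_decomposition_ac_density[OF assms(1,2) sets s'] sets
    by (auto simp: lebesgue_decomposition_def cong: measurable_cong_sets)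
  have "AE x in \<nu>. ennreal (ac_density \<nu> \<mu> x) = ennreal (\<rho> x)"
    using m D sing(2) \<mu> by (intro density_unique) simp_all
  then have "AE x in \<nu>. U (ac_density \<nu> \<mu> x) = U (\<rho> x)"
    using \<rho>(2) D(2) by (auto elim!: eventually_mono)
  then have "ereal_integral \<nu> (\<lambda>x. U (ac_density \<nu> \<mu> x)) = ereal_integral \<nu> (\<lambda>x. U (\<rho> x))"
    by (rule ereal_integral_cong_AE)
  \<comment> \<open>The singular term is 0 even if the slope at infinity is infinite, by the
    convention for products in \<open>ereal\<close>.\<close>
  then show ?thesis
    unfolding U_functional_def sing(1) by (simp add: zero_ennreal.rep_eq)
qed

lemma U_functional_self:
  fixes \<nu> :: "'a::metric_space measure"
  assumes "prob_space \<nu>" and "sets \<nu> = sets borel"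
  shows "U_functional U \<nu> \<nu> = ereal (U 1)"
proof -
  interpret prob_space \<nu> by fact
  have "U_functional U \<nu> \<nu> = ereal_integral \<nu> (\<lambda>x. U 1)"
    using assms by (intro U_functional_density) (simp_all add: density_1)
  also have "\<dots> = ereal (U 1)"
    by (subst ereal_integral_eq) (simp_all add: prob_space)
  finally show ?thesis .
qed

text \<open>The point 1, the constant density of \<nu> with respect to itself, is interior to the
  half-line, so convexity provides a supporting line there.\<close>

lemma convex_on_subgradient_one:
  fixes U :: "real \<Rightarrow> real"
  assumes "convex_on {0..} U"
  obtains p where "\<And>s. 0 \<le> s \<Longrightarrow> U 1 + p * (s - 1) \<le> U s"
  using convex_le_Inf_differential[OF assms, of 1] by auto

text \<open>As \<open>U 0 = 0\<close>, the quotient \<open>U r / r\<close> is the slope of a chord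
  from the origin and hence nondecreasing, so its limit exists as a supremum. The supporting line
  divided by \<open>r\<close> bounds the quotient from below and tends to \<open>p\<close>.\<close>

lemma slope_at_infinity_ge:
  fixes U :: "real \<Rightarrow> real"
  assumes cvx: "convex_on {0..} U" and "U 0 = 0"
    and p: "\<And>s. 0 \<le> s \<Longrightarrow> U 1 + p * (s - 1) \<le> U s"
  shows "ereal p \<le> slope_at_infinity U"
proof -
  have mono: "U r / r \<le> U s / s" if "0 < r" "r \<le> s" for r s
  proof -
    have "U r \<le> r / s * U s"
      using convex_onD[OF cvx, of "r / s" 0 s] that assms(2) by (simp add: field_simps)
    then show ?thesis using that by (simp add: field_simps)
  qed
  define L where "L = (SUP r\<in>{0<..}. ereal (U r / r))"
  have lim: "((\<lambda>r. ereal (U r / r)) \<longlongrightarrow> L) at_top"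
  proof (rule order_tendstoI)
    fix a assume "a < L"
    then obtain r where r: "0 < r" "a < ereal (U r / r)"
      unfolding L_def less_SUP_iff by auto
    have "\<forall>\<^sub>F s in at_top. r \<le> s" by (rule eventually_ge_at_top)
    then show "\<forall>\<^sub>F s in at_top. a < ereal (U s / s)"
    proof eventually_elim
      case (elim s)
      show ?case by (rule less_le_trans[OF r(2)]) (simp add: mono[OF r(1) elim])
    qed
  next
    fix a assume a: "L < a"
    have "\<forall>\<^sub>F s in at_top. (0::real) < s" by (rule eventually_gt_at_top)
    then show "\<forall>\<^sub>F s in at_top. ereal (U s / s) < a"
    proof eventually_elim
      case (elim s)
      then have "ereal (U s / s) \<le> L" unfolding L_def by (intro SUP_upper) simp
      then show ?case using a by (rule le_less_trans)
    qed
  qed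
  \<comment> \<open>\<open>Lim\<close> is a description operator, determined only once convergence
    is known.\<close>
  have eq: "slope_at_infinity U = L"
    unfolding slope_at_infinity_def by (rule tendsto_Lim[OF _ lim]) simp
  have "((\<lambda>r. (U 1 - p) / r + p) \<longlongrightarrow> 0 + p) at_top"
    by (intro tendsto_add tendsto_const tendsto_divide_0[OF tendsto_const]
        filterlim_mono[OF filterlim_ident at_top_le_at_infinity order_refl])
  then have "((\<lambda>r. ereal ((U 1 - p) / r + p)) \<longlongrightarrow> ereal p) at_top" by simp
  moreover have "\<forall>\<^sub>F r in at_top. ereal ((U 1 - p) / r + p) \<le> ereal (U r / r)"
    using eventually_gt_at_top[of "0::real"]
  proof eventually_elim
    case (elim r)
    then have "(U 1 + p * (r - 1)) / r \<le> U r / r"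
      using p[of r] by (intro divide_right_mono) auto
    moreover have "(U 1 + p * (r - 1)) / r = (U 1 - p) / r + p"
      using elim by (simp add: field_simps)
    ultimately show ?case by simp
  qed
  ultimately show ?thesis
    unfolding eq by (rule tendsto_le[OF trivial_limit_at_top_linorder lim])
qed

text \<open>Jensen's inequality; the mass of the singular part is charged at the slope at infinity,
  which dominates every subgradient.\<close>

lemma U_functional_ge:
  fixes \<nu> \<mu> :: "'a::metric_space measure"
  assumes "prob_space \<nu>" and "prob_space \<mu>" and sets: "sets \<nu> = sets borel" "sets \<mu> = sets borel"
    and cvx: "convex_on {0..} U" and "U 0 = 0"
  shows "ereal (U 1) \<le> U_functional U \<nu> \<mu>"
proof -
  interpret nu: prob_space \<nu> by fact
  interpret mu: prob_space \<mu> by fact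
  obtain p where p: "\<And>s. 0 \<le> s \<Longrightarrow> U 1 + p * (s - 1) \<le> U s"
    using convex_on_subgradient_one[OF cvx] by blast
  define D S where "D = ac_density \<nu> \<mu>" and "S = singular_part \<nu> \<mu>"
  have LD: "lebesgue_decomposition \<nu> \<mu> D S"
    unfolding D_def S_def by (rule lebesgue_decomposition_ac_density) fact+
  have Db: "D \<in> borel_measurable \<nu>" and D0: "\<And>x. 0 \<le> D x"
    using LD sets(1) by (auto simp: lebesgue_decomposition_def cong: measurable_cong_sets)
  have sp: "space \<nu> = UNIV" "space \<mu> = UNIV"
    using sets_eq_imp_space_eq[OF sets(1)] sets_eq_imp_space_eq[OF sets(2)] by simp_all
  have "emeasure \<mu> UNIV = emeasure (density \<nu> (\<lambda>x. ennreal (D x))) UNIV + emeasure S UNIV"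
    using LD by (auto simp: lebesgue_decomposition_def)
  moreover have "emeasure (density \<nu> (\<lambda>x. ennreal (D x))) UNIV = (\<integral>\<^sup>+x. ennreal (D x) \<partial>\<nu>)"
    using Db sets by (subst emeasure_density) (auto cong: nn_integral_cong)
  ultimately have sum: "(\<integral>\<^sup>+x. ennreal (D x) \<partial>\<nu>) + emeasure S UNIV = 1"
    using mu.emeasure_space_1 sp by simp
  then have "(\<integral>\<^sup>+x. ennreal (D x) \<partial>\<nu>) \<noteq> \<infinity>" and Sfin: "emeasure S UNIV \<noteq> \<infinity>" by auto
  then have int: "integrable \<nu> D"
    using Db D0 by (intro integrableI_nonneg) (auto simp: less_top)
  define a s where "a = (\<integral>x. D x \<partial>\<nu>)" and "s = enn2real (emeasure S UNIV)"
  have s: "emeasure S UNIV = ennreal s" "0 \<le> s"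
    unfolding s_def using Sfin by (simp_all add: less_top)
  have "(\<integral>\<^sup>+x. ennreal (D x) \<partial>\<nu>) = ennreal a" "0 \<le> a"
    using nn_integral_eq_integral[OF int] D0 unfolding a_def by auto
  with sum s have as: "a + s = 1" by (simp flip: ennreal_plus)
  have "a = 1 - s" using as by simp
  \<comment> \<open>The absolutely continuous mass \<open>a\<close> falls short of 1 by
    \<open>s\<close>, so the supporting line loses exactly \<open>p * s\<close>, which the singular
    term pays back.\<close>
  then have "ereal (U 1) = ereal (U 1 + p * (a - 1)) + ereal p * ereal s" by simp
  also have "ereal (U 1 + p * (a - 1)) = ereal (\<integral>x. U 1 + p * (D x - 1) \<partial>\<nu>)"
    using int unfolding a_def by (simp add: nu.prob_space)
  also have "\<dots> = ereal_integral \<nu> (\<lambda>x. U 1 + p * (D x - 1))"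
    using int by (intro ereal_integral_eq[symmetric]) auto
  also have "\<dots> \<le> ereal_integral \<nu> (\<lambda>x. U (D x))"
    by (rule ereal_integral_mono) (simp add: p D0)
  finally have "ereal (U 1) \<le> ereal_integral \<nu> (\<lambda>x. U (D x)) + ereal p * ereal s"
    by (simp add: add_right_mono)
  also have "\<dots> \<le> ereal_integral \<nu> (\<lambda>x. U (D x)) + slope_at_infinity U * ereal s"
    using s by (intro add_left_mono ereal_mult_right_mono slope_at_infinity_ge[OF cvx assms(6) p]) auto
  also have "\<dots> = U_functional U \<nu> \<mu>"
    unfolding U_functional_def D_def[symmetric] S_def[symmetric] s(1)
    using s(2) by (simp add: enn2ereal_ennreal)
  finally show ?thesis .
qed

text \<open>Minimality at \<nu> bounds the left side of the convexity estimate below by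
  \<open>U 1\<close>. The distance enters only as a number, so \<open>w\<close> may be any real in
  place of its square.\<close>

lemma U_functional_gap_ge:
  fixes \<nu> :: "'a::metric_space measure"
  assumes nu: "prob_space \<nu>" and sets: "sets \<nu> = sets borel"
    and cvx: "convex_on {0..} U" and U0: "U 0 = 0"
    and m: "\<forall>t\<in>{0..1}. m t \<in> P2" and m1: "m 1 = \<nu>"
    and conv: "\<forall>t\<in>{0..1}. U_functional U \<nu> (m t) \<le>
           ereal t * U_functional U \<nu> (m 1) + ereal (1 - t) * U_functional U \<nu> (m 0)
             - ereal (1 / 2 * lam * t * (1 - t) * w)"
  shows "ereal (lam / 2 * w) \<le> U_functional U \<nu> (m 0) - U_functional U \<nu> \<nu>"
proof -
  have ge: "ereal (U 1) \<le> U_functional U \<nu> (m t)" if "t \<in> {0..1}" for t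
    using m that nu sets cvx U0 by (intro U_functional_ge) (auto simp: P2_def)
  note self = U_functional_self[OF nu sets, of U]
  show ?thesis
  proof (cases "U_functional U \<nu> (m 0)")
    case (real u)
    have "t * (lam / 2 * w) \<le> u - U 1" if "0 < t" "t < 1" for t
    proof -
      have "ereal (U 1) \<le> ereal t * ereal (U 1) + ereal (1 - t) * ereal u
             - ereal (1 / 2 * lam * t * (1 - t) * w)"
        using order_trans[OF ge conv[rule_format]] that real self m1 by simp
      then have "(1 - t) * (t * (lam / 2 * w)) \<le> (1 - t) * (u - U 1)"
        by (simp add: algebra_simps)
      then show ?thesis using that by simp
    qed
    \<comment> \<open>This replaces the limit \<open>t \<rightarrow> 1\<close>: a bound on
      \<open>t * x\<close> for every \<open>t\<close> in the open unit interval gives the bound on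
      \<open>x\<close>.\<close>
    then have "lam / 2 * w \<le> u - U 1" by (rule field_le_mult_one_interval)
    then show ?thesis using real self by simp
  next
    \<comment> \<open>Jensen's inequality excludes minus infinity; at plus infinity the difference
      is infinite because the value at \<nu> is finite.\<close>
    case MInf
    then show ?thesis using ge[of 0] by simp
  qed (simp add: self)
qed

section \<open>Couplings on a compact metric space\<close>

text \<open>By total boundedness there are finite nets at every scale; the balls of radius
  \<open>1 / (n + 1)\<close> around them form a countable base.\<close>

lemma compact_UNIV_ball_cover:
  assumes "compact (UNIV :: 'a::metric_space set)"
  obtains B :: "'a::metric_space set set" where "countable B" "\<And>S. S \<in> B \<Longrightarrow> open S"
    "\<And>S x. open S \<Longrightarrow> x \<in> S \<Longrightarrow> \<exists>T\<in>B. x \<in> T \<and> T \<subseteq> S"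
proof -
  have "\<forall>n. \<exists>k. finite k \<and> (UNIV :: 'a set) \<subseteq> (\<Union>x\<in>k. ball x (inverse (real (Suc n))))"
    using assms unfolding compact_eq_totally_bounded by auto
  from choice[OF this] obtain k where k: "\<And>n. finite (k n)"
    "\<And>n. (UNIV :: 'a set) \<subseteq> (\<Union>x\<in>k n. ball x (inverse (real (Suc n))))" by blast
  define B where "B = (\<Union>n. (\<lambda>x. ball x (inverse (real (Suc n)))) ` k n)"
  show ?thesis
  proof
    show "countable B"
      unfolding B_def
      by (intro countable_UN[OF countableI_type] countable_finite finite_imageI k(1))
    show "open S" if "S \<in> B" for S using that by (auto simp: B_def)
    show "\<exists>T\<in>B. x \<in> T \<and> T \<subseteq> S" if S: "open S" "x \<in> S" for S x
    proof -
      obtain e where e: "0 < e" "ball x e \<subseteq> S" using S openE by blast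
      \<comment> \<open>A ball of radius below \<open>e / 2\<close> that contains \<open>x\<close>
        lies in \<open>ball x e\<close>.\<close>
      obtain n where n: "inverse (real (Suc n)) < e / 2"
        using reals_Archimedean[of "e / 2"] e by auto
      obtain y where y: "y \<in> k n" "x \<in> ball y (inverse (real (Suc n)))" using k(2)[of n] by blast
      have "ball y (inverse (real (Suc n))) \<subseteq> ball x e"
      proof
        fix z assume "z \<in> ball y (inverse (real (Suc n)))"
        then show "z \<in> ball x e"
          using y n dist_triangle[of x z y] by (simp add: dist_commute)
      qed
      with y e show ?thesis unfolding B_def by blast
    qed
  qed
qed

text \<open>The library's \<open>borel_prod\<close> is not applicable: a compact metric space is second countable,
  but its type is not an instance of that class.\<close>

lemma sets_borel_prod_compact:
  assumes "compact (UNIV :: 'a::metric_space set)"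
  shows "sets (borel \<Otimes>\<^sub>M borel) = sets (borel :: ('a \<times> 'a) measure)"
proof
  \<comment> \<open>Both projections are continuous, so the identity is measurable from the Borel
    sets into the product sigma-algebra.\<close>
  have "(\<lambda>p::'a \<times> 'a. (fst p, snd p)) \<in> borel \<rightarrow>\<^sub>M borel \<Otimes>\<^sub>M borel"
    by (intro measurable_Pair borel_measurable_continuous_onI continuous_intros)
  then have m: "id \<in> borel \<rightarrow>\<^sub>M (borel \<Otimes>\<^sub>M borel :: ('a \<times> 'a) measure)"
    by (simp add: id_def)
  show "sets (borel \<Otimes>\<^sub>M borel) \<subseteq> sets (borel :: ('a \<times> 'a) measure)"
  proof
    fix A assume "A \<in> sets (borel \<Otimes>\<^sub>M borel :: ('a \<times> 'a) measure)"
    from measurable_sets[OF m this] show "A \<in> sets borel" by simp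
  qed
next
  obtain B :: "'a set set" where B: "countable B" "\<And>S. S \<in> B \<Longrightarrow> open S"
    "\<And>S x. open S \<Longrightarrow> x \<in> S \<Longrightarrow> \<exists>T\<in>B. x \<in> T \<and> T \<subseteq> S"
    using compact_UNIV_ball_cover[OF assms] by blast
  have "S \<in> sets (borel \<Otimes>\<^sub>M borel)" if S: "open S" for S :: "('a \<times> 'a) set"
  proof -
    \<comment> \<open>The rectangles of base sets inside \<open>S\<close> are countably many and
      exhaust it.\<close>
    let ?C = "{P \<in> B \<times> B. fst P \<times> snd P \<subseteq> S}"
    have "S \<subseteq> (\<Union>P\<in>?C. fst P \<times> snd P)"
    proof
      fix p assume "p \<in> S"
      then obtain V W where VW: "open V" "open W" "p \<in> V \<times> W" "V \<times> W \<subseteq> S"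
        using S unfolding open_prod_def by meson
      obtain T T' where "T \<in> B" "fst p \<in> T" "T \<subseteq> V" "T' \<in> B" "snd p \<in> T'" "T' \<subseteq> W"
        using B(3)[OF VW(1), of "fst p"] B(3)[OF VW(2), of "snd p"] VW(3)
        by (auto simp: mem_Times_iff)
      then have "(T, T') \<in> ?C" "p \<in> T \<times> T'" using VW(4) by (auto simp: mem_Times_iff)
      then show "p \<in> (\<Union>P\<in>?C. fst P \<times> snd P)" by force
    qed
    then have "S = (\<Union>P\<in>?C. fst P \<times> snd P)" by blast
    also have "\<dots> \<in> sets (borel \<Otimes>\<^sub>M borel)"
    proof (rule sets.countable_UN'')
      show "countable ?C"
        using B(1) by (intro countable_subset[OF _ countable_SIGMA[OF B(1)]]) auto
      fix P assume "P \<in> ?C"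
      then show "fst P \<times> snd P \<in> sets (borel \<Otimes>\<^sub>M borel)" using B(2) by (intro pair_measureI) auto
    qed
    finally show ?thesis .
  qed
  then show "sets (borel :: ('a \<times> 'a) measure) \<subseteq> sets (borel \<Otimes>\<^sub>M borel)"
    using sets.sigma_sets_subset[of "{S. open S}" "borel \<Otimes>\<^sub>M borel :: ('a \<times> 'a) measure"]
    by (auto simp: borel_def space_pair_measure)
qed

text \<open>The product measure is a coupling, its sigma-algebra being the Borel one by compactness.
  This keeps the real infimum in \<open>W2\<close> from being taken over the empty set.\<close>

lemma couplings_nonempty:
  fixes \<mu> \<nu> :: "'a::metric_space measure"
  assumes "compact (UNIV :: 'a set)" and "\<mu> \<in> P2" "\<nu> \<in> P2"
  shows "couplings \<mu> \<nu> \<noteq> {}"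
proof -
  have sets: "sets \<mu> = sets borel" "sets \<nu> = sets borel" and "prob_space \<mu>" "prob_space \<nu>"
    using assms by (auto simp: P2_def)
  interpret mu: prob_space \<mu> by fact
  interpret nu: prob_space \<nu> by fact
  interpret pair_prob_space \<mu> \<nu> ..
  have s: "sets (\<mu> \<Otimes>\<^sub>M \<nu>) = sets borel"
    using sets_borel_prod_compact[OF assms(1)] sets_pair_measure_cong[OF sets] by simp
  have sp: "space \<mu> = UNIV" "space \<nu> = UNIV" using assms by (simp_all add: P2_space)
  have spp: "space (\<mu> \<Otimes>\<^sub>M \<nu>) = UNIV" using sp by (simp add: space_pair_measure)
  have fs: "fst \<in> (\<mu> \<Otimes>\<^sub>M \<nu>) \<rightarrow>\<^sub>M borel" "snd \<in> (\<mu> \<Otimes>\<^sub>M \<nu>) \<rightarrow>\<^sub>M borel"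
    using measurable_fst[of \<mu> \<nu>] measurable_snd[of \<mu> \<nu>] sets by (simp_all cong: measurable_cong_sets)
  have "distr (\<mu> \<Otimes>\<^sub>M \<nu>) borel fst = \<mu>"
  proof (rule measure_eqI)
    fix A assume A: "A \<in> sets (distr (\<mu> \<Otimes>\<^sub>M \<nu>) borel fst)"
    have "fst -` A = A \<times> (UNIV :: 'a set)" by auto
    with A sets fs sp show "emeasure (distr (\<mu> \<Otimes>\<^sub>M \<nu>) borel fst) A = emeasure \<mu> A"
      using nu.emeasure_space_1 sets.top[of \<nu>]
      by (simp add: emeasure_distr spp nu.emeasure_pair_measure_Times)
  qed (use sets in simp)
  moreover have "distr (\<mu> \<Otimes>\<^sub>M \<nu>) borel snd = \<nu>"
  proof (rule measure_eqI)
    fix A assume A: "A \<in> sets (distr (\<mu> \<Otimes>\<^sub>M \<nu>) borel snd)"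
    have "snd -` A = (UNIV :: 'a set) \<times> A" by auto
    with A sets fs sp show "emeasure (distr (\<mu> \<Otimes>\<^sub>M \<nu>) borel snd) A = emeasure \<nu> A"
      using mu.emeasure_space_1 sets.top[of \<mu>]
      by (simp add: emeasure_distr spp nu.emeasure_pair_measure_Times)
  qed (use sets in simp)
  ultimately have "\<mu> \<Otimes>\<^sub>M \<nu> \<in> couplings \<mu> \<nu>"
    unfolding couplings_def using s prob_space_axioms by auto
  then show ?thesis by blast
qed

text \<open>With \<open>0 < c\<close> the bound can be solved for the transport cost and so becomes
  a lower bound for all the costs whose infimum defines \<open>W2\<close>.\<close>

lemma le_W2_affine:
  fixes \<mu> \<nu> :: "'a::metric_space measure"
  assumes "compact (UNIV :: 'a set)" and "\<mu> \<in> P2" "\<nu> \<in> P2" and "0 < c"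
    and le: "\<And>\<gamma>. \<gamma> \<in> couplings \<mu> \<nu> \<Longrightarrow> e \<le> c * (\<integral>p. (dist (fst p) (snd p))\<^sup>2 \<partial>\<gamma>) + d"
  shows "e \<le> c * (W2 \<mu> \<nu>)\<^sup>2 + d"
proof -
  let ?c = "\<lambda>\<gamma>. (\<integral>p. (dist (fst p) (snd p))\<^sup>2 \<partial>\<gamma>) :: real"
  note ne = couplings_nonempty[OF assms(1-3)]
  \<comment> \<open>Nonnegativity of the infimum lets the square undo the root in
    \<open>W2\<close>.\<close>
  have "0 \<le> Inf (?c ` couplings \<mu> \<nu>)"
    using ne by (intro cINF_greatest integral_nonneg_AE) auto
  then have W: "(W2 \<mu> \<nu>)\<^sup>2 = Inf (?c ` couplings \<mu> \<nu>)" by (simp add: W2_def)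
  have "(e - d) / c \<le> (W2 \<mu> \<nu>)\<^sup>2"
    unfolding W
  proof (rule cINF_greatest[OF ne])
    fix \<gamma> assume "\<gamma> \<in> couplings \<mu> \<nu>"
    from le[OF this] show "(e - d) / c \<le> ?c \<gamma>" using assms(4) by (simp add: field_simps)
  qed
  then show ?thesis using assms(4) by (simp add: field_simps)
qed

lemma integrable_continuous_compact_UNIV:
  fixes f :: "'a::metric_space \<Rightarrow> real"
  assumes "compact (UNIV :: 'a set)" and "finite_measure M" "sets M = sets borel"
    and f: "continuous_on UNIV f"
  shows "integrable M f"
proof -
  have "bounded (range f)" using assms(1) f by (simp add: compact_continuous_image compact_imp_bounded)
  then obtain b where b: "\<And>x. \<bar>f x\<bar> \<le> b" unfolding bounded_real by blast
  have "f \<in> borel_measurable M"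
    using borel_measurable_continuous_onI[OF f] assms(3) by (simp cong: measurable_cong_sets)
  then show ?thesis
    using b by (intro finite_measure.integrable_const_bound[OF assms(2), where B = b]) auto
qed

section \<open>The descending slope\<close>

text \<open>The descending slope at a fixed scale \<open>r\<close>. In \<open>ennreal\<close> an
  empty supremum is 0, which agrees with the convention at isolated points.\<close>

definition local_slope :: "('a::metric_space \<Rightarrow> real) \<Rightarrow> real \<Rightarrow> 'a \<Rightarrow> ennreal" where
  "local_slope h r x = (SUP y\<in>ball x r - {x}. ennreal (max (h x - h y) 0 / dist x y))"

text \<open>The limit superior is an infimum over punctured balls; a sequence of radii suffices by
  monotonicity in \<open>r\<close> and makes monotone convergence applicable.\<close>

lemma descending_slope_eq_INF_local_slope:
  "descending_slope h x = (INF n. local_slope h (inverse (real (Suc n))) x)"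
proof -
  have "descending_slope h x = (INF r\<in>{0<..}. local_slope h r x)"
    unfolding descending_slope_def local_slope_def
    using Limsup_within[of x UNIV "\<lambda>y. ennreal (max (h x - h y) 0 / dist x y)"] by simp
  also have "\<dots> = (INF n. local_slope h (inverse (real (Suc n))) x)"
  proof (rule antisym)
    show "(INF n. local_slope h (inverse (real (Suc n))) x) \<le> (INF r\<in>{0<..}. local_slope h r x)"
    proof (rule INF_greatest)
      fix r :: real assume "r \<in> {0<..}"
      then obtain n where "inverse (real (Suc n)) < r" using reals_Archimedean[of r] by auto
      then have "local_slope h (inverse (real (Suc n))) x \<le> local_slope h r x"
        unfolding local_slope_def by (intro SUP_subset_mono) auto
      then show "(INF n. local_slope h (inverse (real (Suc n))) x) \<le> local_slope h r x"
        by (rule INF_lower2[OF UNIV_I])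
    qed
    show "(INF r\<in>{0<..}. local_slope h r x) \<le> (INF n. local_slope h (inverse (real (Suc n))) x)"
      by (intro INF_mono) auto
  qed
  finally show ?thesis .
qed

lemma decseq_local_slope: "decseq (\<lambda>n. local_slope h (inverse (real (Suc n))))"
  unfolding local_slope_def
  by (intro antimonoI le_funI SUP_subset_mono Diff_mono subset_ball le_imp_inverse_le) auto

lemma local_slope_le_lipschitz:
  assumes "K-lipschitz_on UNIV h"
  shows "local_slope h r x \<le> ennreal K"
  unfolding local_slope_def
proof (rule SUP_least)
  fix y assume "y \<in> ball x r - {x}"
  then have "0 < dist x y" by auto
  moreover have "h x - h y \<le> K * dist x y"
    using lipschitz_onD[OF assms, of x y] by (simp add: dist_real_def)
  ultimately show "ennreal (max (h x - h y) 0 / dist x y) \<le> ennreal K"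
    using lipschitz_on_nonneg[OF assms] by (intro ennreal_leI) (simp add: divide_simps)
qed

text \<open>As a supremum over \<open>y\<close> of functions that are continuous on an open set and vanish outside
  it, the local slope is lower semicontinuous.\<close>

lemma borel_measurable_local_slope:
  fixes h :: "'a::metric_space \<Rightarrow> real"
  assumes h: "continuous_on UNIV h"
  shows "local_slope h r \<in> borel_measurable borel"
proof (rule borel_measurableI_greater)
  fix c :: ennreal
  let ?q = "\<lambda>y x. ennreal (max (h x - h y) 0 / dist x y)"
  have "{x. c < local_slope h r x} = (\<Union>y. (ball y r - {y}) \<inter> ?q y -` {c<..})"
    unfolding local_slope_def less_SUP_iff by (auto simp: dist_commute)
  moreover have "open ((ball y r - {y}) \<inter> ?q y -` {c<..})" for y
  proof (rule continuous_open_preimage)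
    show "continuous_on (ball y r - {y}) (?q y)"
      by (intro continuous_on_ennreal continuous_intros continuous_on_subset[OF h]) auto
  qed (auto intro: open_delete)
  ultimately show "{x \<in> space borel. c < local_slope h r x} \<in> sets borel"
    by (simp add: open_UN)
qed

section \<open>Elementary inequalities with a free weight\<close>

lemma le_mult_if_le_add_mult_add:
  fixes a b c :: real
  assumes "\<And>\<delta>. 0 < \<delta> \<Longrightarrow> c \<le> (a + \<delta>) * (b + \<delta>)"
  shows "c \<le> a * b"
proof -
  have "((\<lambda>\<delta>. (a + \<delta>) * (b + \<delta>)) \<longlongrightarrow> (a + 0) * (b + 0)) (at_right 0)"
    by (intro tendsto_intros)
  then have "((\<lambda>\<delta>. (a + \<delta>) * (b + \<delta>)) \<longlongrightarrow> a * b) (at_right 0)" by simp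
  then show ?thesis
    by (rule tendsto_lowerbound)
      (auto intro!: eventually_mono[OF eventually_at_right_less] assms)
qed

text \<open>The right side is smallest at \<open>b = s / w\<close>, where it equals
  \<open>w * s\<close>. This recovers the Cauchy-Schwarz form after the weighted bound has passed
  through all limits.\<close>

lemma le_mult_if_le_weighted_squares:
  fixes c w s :: real
  assumes "0 \<le> w" "0 \<le> s" and le: "\<And>b. 0 < b \<Longrightarrow> c \<le> (b * w\<^sup>2 + s\<^sup>2 / b) / 2"
  shows "c \<le> w * s"
proof (rule le_mult_if_le_add_mult_add)
  fix \<delta> :: real assume \<delta>: "0 < \<delta>"
  \<comment> \<open>The optimal weight, shifted by \<delta> so that it is defined and positive even
    if \<open>w\<close> or \<open>s\<close> is 0.\<close>
  define b where "b = (s + \<delta>) / (w + \<delta>)"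
  have b: "0 < b" using assms \<delta> by (simp add: b_def)
  have "b * w\<^sup>2 \<le> b * (w + \<delta>)\<^sup>2"
    using assms \<delta> b by (intro mult_left_mono power_mono) auto
  also have "\<dots> = (w + \<delta>) * (s + \<delta>)"
    using assms \<delta> by (simp add: b_def power2_eq_square)
  finally have 1: "b * w\<^sup>2 \<le> (w + \<delta>) * (s + \<delta>)" .
  have "s\<^sup>2 / b \<le> (s + \<delta>)\<^sup>2 / b"
    using assms \<delta> b by (intro divide_right_mono power_mono) auto
  also have "\<dots> = (w + \<delta>) * (s + \<delta>)"
    using assms \<delta> by (simp add: b_def power2_eq_square)
  finally show "c \<le> (w + \<delta>) * (s + \<delta>)"
    using le[OF b] 1 by simp
qed

text \<open>Young's inequality with weight \<open>a\<close>, from the square of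
  \<open>a * d - g\<close>.\<close>

lemma mult_le_weighted_squares:
  fixes a d g :: real
  assumes "0 < a"
  shows "g * d \<le> a / 2 * d\<^sup>2 + g\<^sup>2 / (2 * a)"
proof -
  have "0 \<le> (a * d - g)\<^sup>2 / (2 * a)" using assms by simp
  also have "\<dots> = a / 2 * d\<^sup>2 + g\<^sup>2 / (2 * a) - g * d"
    using assms by (simp add: power2_eq_square field_simps)
  finally show ?thesis by simp
qed

section \<open>Derivatives of a convex function and slopes of compositions\<close>

lemma convex_on_above_tangent_deriv:
  fixes U :: "real \<Rightarrow> real"
  assumes "convex_on {0..} U" and "U differentiable at r" and "0 < r" "0 \<le> s"
  shows "deriv U r * (s - r) \<le> U s - U r"
proof (rule convex_on_imp_above_tangent[OF assms(1)])
  have "(U has_real_derivative deriv U r) (at r)"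
    using assms(2) by (simp add: DERIV_deriv_iff_real_differentiable)
  then show "(U has_real_derivative deriv U r) (at r within {0..})"
    by (rule has_field_derivative_at_within)
qed (use assms in auto)

text \<open>Add the tangent inequalities at \<open>r\<close> and at \<open>s\<close>.\<close>

lemma convex_on_deriv_mono:
  fixes U :: "real \<Rightarrow> real"
  assumes cvx: "convex_on {0..} U" and diff: "\<And>r. 0 < r \<Longrightarrow> U differentiable at r"
    and rs: "0 < r" "r \<le> s"
  shows "deriv U r \<le> deriv U s"
proof (cases "r = s")
  case False
  have "deriv U r * (s - r) \<le> deriv U s * (s - r)"
    using convex_on_above_tangent_deriv[OF cvx diff, of r s]
      convex_on_above_tangent_deriv[OF cvx diff, of s r] rs
    by (simp add: algebra_simps)
  then show ?thesis using False rs by simp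
qed simp

lemma descending_slope_le_lipschitz:
  assumes "L-lipschitz_on UNIV \<rho>"
  shows "descending_slope \<rho> x \<le> ennreal L"
  unfolding descending_slope_eq_INF_local_slope
  by (rule INF_lower2[OF UNIV_I, where i = 0]) (rule local_slope_le_lipschitz[OF assms])

text \<open>A chain rule. As \<open>v\<close> is nondecreasing, only points \<open>y\<close> with
  \<open>\<rho> y < \<rho> x\<close> contribute, and there the increment of \<open>v\<close> is at
  most \<open>D + \<delta>\<close> times that of \<rho>.\<close>

lemma descending_slope_comp_le:
  fixes \<rho> :: "'a::metric_space \<Rightarrow> real"
  assumes mono: "\<And>r s. 0 < r \<Longrightarrow> r \<le> s \<Longrightarrow> v r \<le> v s"
    and deriv: "(v has_real_derivative D) (at (\<rho> x))"
    and pos: "\<And>x. 0 < \<rho> x" and L: "L-lipschitz_on UNIV \<rho>"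
  shows "descending_slope (\<lambda>x. v (\<rho> x)) x \<le> ennreal D * descending_slope \<rho> x"
proof -
  let ?h = "\<lambda>x. v (\<rho> x)"
  have D0: "0 \<le> D"
  proof (rule ccontr)
    assume "\<not> 0 \<le> D"
    then obtain d where d: "0 < d" "\<And>h. 0 < h \<Longrightarrow> h < d \<Longrightarrow> v (\<rho> x + h) < v (\<rho> x)"
      using DERIV_neg_dec_right[OF deriv] by (meson not_le)
    have "v (\<rho> x + d / 2) < v (\<rho> x)" using d(1) by (intro d(2)) auto
    moreover have "v (\<rho> x) \<le> v (\<rho> x + d / 2)" using d(1) pos[of x] by (intro mono) auto
    ultimately show False by simp
  qed
  have fin: "descending_slope \<rho> x < \<top>"
    using descending_slope_le_lipschitz[OF L] by (rule le_less_trans) simp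
  define s where "s = enn2real (descending_slope \<rho> x)"
  have s: "descending_slope \<rho> x = ennreal s" "0 \<le> s"
    using fin by (simp_all add: s_def)
  have le: "descending_slope ?h x \<le> ennreal ((D + \<delta>) * (s + \<delta>))" if \<delta>: "0 < \<delta>" for \<delta>
    unfolding descending_slope_def
  proof (rule Limsup_bounded)
    have "Limsup (at x) (\<lambda>y. ennreal (max (\<rho> x - \<rho> y) 0 / dist x y)) < ennreal (s + \<delta>)"
      using s \<delta> unfolding descending_slope_def by (simp add: ennreal_lessI)
    then have ev1: "\<forall>\<^sub>F y in at x. ennreal (max (\<rho> x - \<rho> y) 0 / dist x y) < ennreal (s + \<delta>)"
      by (rule Limsup_lessD)
    have "((\<lambda>z. (v z - v (\<rho> x)) / (z - \<rho> x)) \<longlongrightarrow> D) (at (\<rho> x))"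
      using deriv by (simp add: has_field_derivative_iff)
    then have "\<forall>\<^sub>F z in at (\<rho> x). (v z - v (\<rho> x)) / (z - \<rho> x) < D + \<delta>"
      using \<delta> by (intro order_tendstoD(2)) auto
    \<comment> \<open>The guard \<open>z \<noteq> \<rho> x\<close> moves into the predicate, since
      \<rho> may take the value \<open>\<rho> x\<close> at points arbitrarily close to
      \<open>x\<close>.\<close>
    then have "\<forall>\<^sub>F z in nhds (\<rho> x). z \<noteq> \<rho> x \<longrightarrow> (v z - v (\<rho> x)) / (z - \<rho> x) < D + \<delta>"
      by (simp add: eventually_at_filter)
    moreover have "(\<rho> \<longlongrightarrow> \<rho> x) (at x)"
      using lipschitz_on_continuous_on[OF L] by (simp add: continuous_on_def)
    ultimately have ev2: "\<forall>\<^sub>F y in at x. \<rho> y \<noteq> \<rho> x \<longrightarrow> (v (\<rho> y) - v (\<rho> x)) / (\<rho> y - \<rho> x) < D + \<delta>"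
      by (rule eventually_compose_filterlim)
    have ev3: "\<forall>\<^sub>F y in at x. y \<noteq> x" by (simp add: eventually_at_filter)
    from ev1 ev2 ev3
    show "\<forall>\<^sub>F y in at x. ennreal (max (?h x - ?h y) 0 / dist x y) \<le> ennreal ((D + \<delta>) * (s + \<delta>))"
    proof eventually_elim
      case (elim y)
      then have d: "0 < dist x y" by auto
      have "max (?h x - ?h y) 0 \<le> (D + \<delta>) * max (\<rho> x - \<rho> y) 0"
      proof (cases "\<rho> y < \<rho> x")
        case True
        then have "?h x - ?h y \<le> (D + \<delta>) * (\<rho> x - \<rho> y)"
          using elim(2) by (simp add: neg_divide_less_eq algebra_simps)
        with True D0 \<delta> show ?thesis by simp
      next
        case False
        then show ?thesis using mono[OF pos, of x "\<rho> y"] by simp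
      qed
      then have "max (?h x - ?h y) 0 / dist x y \<le> (D + \<delta>) * (max (\<rho> x - \<rho> y) 0 / dist x y)"
        using d by (simp add: divide_right_mono)
      also have "\<dots> \<le> (D + \<delta>) * (s + \<delta>)"
      proof (rule mult_left_mono)
        show "max (\<rho> x - \<rho> y) 0 / dist x y \<le> s + \<delta>"
          using less_imp_le[OF elim(1)] \<delta> s(2) by (subst (asm) ennreal_le_iff) auto
      qed (use D0 \<delta> in simp)
      finally show ?case by (rule ennreal_leI)
    qed
  qed
  \<comment> \<open>Finiteness allows the limit in \<delta> to be taken in the reals.\<close>
  have fin': "descending_slope ?h x < \<top>"
    using le[of 1] by (rule le_less_trans) simp_all
  have "enn2real (descending_slope ?h x) \<le> D * s"
  proof (rule le_mult_if_le_add_mult_add)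
    fix \<delta> :: real assume "0 < \<delta>"
    then show "enn2real (descending_slope ?h x) \<le> (D + \<delta>) * (s + \<delta>)"
      using le[of \<delta>] D0 s(2) by (intro enn2real_leI) auto
  qed
  then have "ennreal (enn2real (descending_slope ?h x)) \<le> ennreal (D * s)" by (rule ennreal_leI)
  then show ?thesis
    using fin' D0 s by (simp add: ennreal_mult)
qed

text \<open>By compactness \<rho> takes its values in a compact interval of positive numbers, where
  \<open>U''\<close> is bounded and \<open>U'\<close> therefore Lipschitz.\<close>

lemma deriv_comp_lipschitz:
  fixes \<rho> :: "'a::metric_space \<Rightarrow> real"
  assumes "compact (UNIV :: 'a set)" and U: "C2_on_positive U"
    and pos: "\<And>x. 0 < \<rho> x" and L: "L-lipschitz_on UNIV \<rho>"
  obtains K where "K-lipschitz_on UNIV (\<lambda>x. deriv U (\<rho> x))"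
proof -
  have cont: "continuous_on UNIV \<rho>" using L by (rule lipschitz_on_continuous_on)
  obtain x0 x1 where x: "\<And>x. \<rho> x0 \<le> \<rho> x" "\<And>x. \<rho> x \<le> \<rho> x1"
    using continuous_attains_inf[OF assms(1) _ cont] continuous_attains_sup[OF assms(1) _ cont] by auto
  let ?I = "{\<rho> x0..\<rho> x1}"
  have I: "?I \<subseteq> {0<..}" using pos[of x0] by auto
  have "continuous_on ?I (deriv (deriv U))"
    using U I unfolding C2_on_positive_def by (blast intro: continuous_on_subset)
  then have "bounded (deriv (deriv U) ` ?I)"
    by (intro compact_imp_bounded compact_continuous_image) auto
  then obtain K where K: "\<And>r. r \<in> ?I \<Longrightarrow> \<bar>deriv (deriv U) r\<bar> \<le> K"
    unfolding bounded_real by blast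
  have "K-lipschitz_on ?I (deriv U)"
  proof (rule lipschitz_onI)
    show "0 \<le> K" using K[of "\<rho> x0"] x by force
    fix r s assume rs: "r \<in> ?I" "s \<in> ?I"
    have "norm (deriv U r - deriv U s) \<le> K * norm (r - s)"
    proof (rule field_differentiable_bound[of ?I])
      fix z assume z: "z \<in> ?I"
      then have "deriv U differentiable at z" using U I unfolding C2_on_positive_def by auto
      then show "(deriv U has_field_derivative deriv (deriv U) z) (at z within ?I)"
        by (simp add: DERIV_deriv_iff_real_differentiable has_field_derivative_at_within)
      show "norm (deriv (deriv U) z) \<le> K" using K[OF z] by simp
    qed (use rs in auto)
    then show "dist (deriv U r) (deriv U s) \<le> K * dist r s" by (simp add: dist_real_def)
  qed
  moreover have "\<rho> ` UNIV \<subseteq> ?I" using x by auto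
  ultimately have "K-lipschitz_on (\<rho> ` UNIV) (deriv U)" by (rule lipschitz_on_subset)
  from lipschitz_on_compose2[OF L this] show ?thesis by (rule that)
qed

section \<open>The HWI inequality\<close>

text \<open>The tangent inequality at \<open>\<rho> x\<close>, integrated against \<nu>. What
  remains are integrals of \<open>h = U' \<circ> \<rho>\<close> against the two measures, which any
  coupling can evaluate.\<close>

lemma U_functional_tangent:
  fixes \<nu> \<mu>' :: "'a::metric_space measure" and \<rho> :: "'a \<Rightarrow> real"
  assumes comp: "compact (UNIV :: 'a set)" and "prob_space \<nu>" and sets: "sets \<nu> = sets borel"
    and Uc: "continuous_on {0..} U" and cvx: "convex_on {0..} U"
    and diff: "\<And>r. 0 < r \<Longrightarrow> U differentiable at r"
    and \<rho>: "continuous_on UNIV \<rho>" "\<And>x. 0 < \<rho> x"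
    and h: "continuous_on UNIV (\<lambda>x. deriv U (\<rho> x))"
    and \<mu>: "\<mu> = density \<nu> (\<lambda>x. ennreal (\<rho> x))" "prob_space \<mu>"
    and \<mu>': "absolutely_continuous \<nu> \<mu>'" "prob_space \<mu>'" "sets \<mu>' = sets borel"
  obtains u where "U_functional U \<nu> \<mu> = ereal u"
    and "ereal (u - ((\<integral>x. deriv U (\<rho> x) \<partial>\<mu>) - (\<integral>x. deriv U (\<rho> x) \<partial>\<mu>'))) \<le> U_functional U \<nu> \<mu>'"
proof -
  interpret nu: prob_space \<nu> by fact
  interpret mu': prob_space \<mu>' by fact
  let ?h = "\<lambda>x. deriv U (\<rho> x)"
  have int: "integrable \<nu> f" if "continuous_on UNIV f" for f :: "'a \<Rightarrow> real"
    using comp nu.finite_measure_axioms sets that by (rule integrable_continuous_compact_UNIV)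
  have \<rho>0: "\<And>x. 0 \<le> \<rho> x" using \<rho>(2) by (simp add: less_imp_le)
  have m: "f \<in> borel_measurable \<nu>" if "continuous_on UNIV f" for f :: "'a \<Rightarrow> real"
    using int[OF that] by auto
  have "continuous_on UNIV (\<lambda>x. U (\<rho> x))"
    using \<rho>0 by (intro continuous_on_compose2[OF Uc \<rho>(1)]) auto
  then have intU: "integrable \<nu> (\<lambda>x. U (\<rho> x))" by (rule int)
  have inth: "integrable \<nu> (\<lambda>x. \<rho> x * ?h x)" by (intro int continuous_intros \<rho> h)
  have eq0: "U_functional U \<nu> \<mu> = ereal (\<integral>x. U (\<rho> x) \<partial>\<nu>)"
    using U_functional_density[OF assms(2) \<mu>(2) sets \<mu>(1) borel_measurable_continuous_onI[OF \<rho>(1)] \<rho>0]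
      ereal_integral_eq[OF intU] by simp
  define D where "D = ac_density \<nu> \<mu>'"
  have Db: "D \<in> borel_measurable borel" and D0: "\<And>x. 0 \<le> D x"
    using lebesgue_decomposition_ac_density[OF assms(2) \<mu>'(2) sets \<mu>'(3)]
    by (auto simp: lebesgue_decomposition_def D_def)
  have Dm: "D \<in> borel_measurable \<nu>" using Db sets by (simp cong: measurable_cong_sets)
  have dens: "\<mu>' = density \<nu> (\<lambda>x. ennreal (D x))"
    using absolutely_continuous_singular_part(2)[OF assms(2) \<mu>'(2) sets \<mu>'(3,1)] by (simp add: D_def)
  have eq1: "U_functional U \<nu> \<mu>' = ereal_integral \<nu> (\<lambda>x. U (D x))"
    by (rule U_functional_density[OF assms(2) \<mu>'(2) sets dens Db D0])
  \<comment> \<open>\<open>D\<close> may be unbounded, so integrability of \<open>D * h\<close> is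
    taken from \<mu>', against which the continuous \<open>h\<close> is integrable.\<close>
  have "integrable \<mu>' ?h"
    using comp mu'.finite_measure_axioms \<mu>'(3) h by (rule integrable_continuous_compact_UNIV)
  then have intD: "integrable \<nu> (\<lambda>x. D x * ?h x)"
    using Dm D0 m[OF h] by (subst (asm) dens, subst (asm) integrable_real_density) auto
  have "ereal ((\<integral>x. U (\<rho> x) \<partial>\<nu>) - ((\<integral>x. ?h x \<partial>\<mu>) - (\<integral>x. ?h x \<partial>\<mu>')))
    = ereal (\<integral>x. U (\<rho> x) - (\<rho> x * ?h x - D x * ?h x) \<partial>\<nu>)"
    using intU inth intD m[OF h] m[OF \<rho>(1)] \<rho>0 Dm D0
    by (simp add: \<mu>(1) dens integral_real_density)
  also have "\<dots> = ereal_integral \<nu> (\<lambda>x. U (\<rho> x) - (\<rho> x * ?h x - D x * ?h x))"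
    using intU inth intD by (intro ereal_integral_eq[symmetric]) auto
  \<comment> \<open>The comparison is made in \<open>ereal\<close> because the integral of
    \<open>U \<circ> D\<close> may be infinite.\<close>
  also have "\<dots> \<le> U_functional U \<nu> \<mu>'"
    unfolding eq1
  proof (rule ereal_integral_mono, rule AE_I2)
    fix x
    have "?h x * (D x - \<rho> x) \<le> U (D x) - U (\<rho> x)"
      by (rule convex_on_above_tangent_deriv[OF cvx diff \<rho>(2) D0]) (rule \<rho>(2))
    then show "U (\<rho> x) - (\<rho> x * ?h x - D x * ?h x) \<le> U (D x)" by (simp add: algebra_simps)
  qed
  finally show ?thesis using eq0 by (rule that[rotated])
qed

text \<open>Splitting at distance \<open>r\<close>: below it the increment of \<open>h\<close> is controlled by the local slope,
  above it by the Lipschitz constant, and Chebyshev's inequality makes the latter part small.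
  The weighted inequality replaces Cauchy-Schwarz, so that the bound is affine in the
  transport cost and passes to the infimum over all couplings.\<close>

lemma coupling_increment_le:
  fixes h :: "'a::metric_space \<Rightarrow> real"
  assumes comp: "compact (UNIV :: 'a set)" and \<gamma>: "\<gamma> \<in> couplings \<mu> \<mu>'"
    and K: "K-lipschitz_on UNIV h" and r: "0 < r" and a: "0 < a"
  shows "(\<integral>x. h x \<partial>\<mu>) - (\<integral>x. h x \<partial>\<mu>') \<le>
    (a / 2 + (K / r)\<^sup>2 / (2 * a)) * (\<integral>p. (dist (fst p) (snd p))\<^sup>2 \<partial>\<gamma>) +
    (\<integral>x. (enn2real (local_slope h r x))\<^sup>2 \<partial>\<mu>) / (2 * a)"
proof -
  have sets: "sets \<gamma> = sets borel" and "prob_space \<gamma>"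
    and \<mu>: "\<mu> = distr \<gamma> borel fst" and \<mu>': "\<mu>' = distr \<gamma> borel snd"
    using \<gamma> by (auto simp: couplings_def)
  interpret prob_space \<gamma> by fact
  define G where "G x = enn2real (local_slope h r x)" for x
  have K0: "0 \<le> K" using K by (rule lipschitz_on_nonneg)
  have hc: "continuous_on UNIV h" using K by (rule lipschitz_on_continuous_on)
  have G: "G \<in> borel_measurable borel"
    unfolding G_def using borel_measurable_local_slope[OF hc] by measurable
  have Gle: "G x \<le> K" for x
    unfolding G_def using local_slope_le_lipschitz[OF K] K0 by (intro enn2real_leI) auto
  have comp2: "compact (UNIV :: ('a \<times> 'a) set)"
    using compact_Times[OF comp comp] by simp
  have int: "integrable \<gamma> f" if "continuous_on UNIV f" for f :: "'a \<times> 'a \<Rightarrow> real"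
    using comp2 finite_measure_axioms sets that by (rule integrable_continuous_compact_UNIV)
  have fs: "fst \<in> \<gamma> \<rightarrow>\<^sub>M borel" "snd \<in> \<gamma> \<rightarrow>\<^sub>M borel"
    using sets by (auto intro!: borel_measurable_continuous_onI continuous_intros
        cong: measurable_cong_sets)
  have hb: "h \<in> borel_measurable borel" using hc by (rule borel_measurable_continuous_onI)
  have e1: "(\<integral>x. h x \<partial>\<mu>) = (\<integral>p. h (fst p) \<partial>\<gamma>)" unfolding \<mu> by (rule integral_distr[OF fs(1) hb])
  have e2: "(\<integral>x. h x \<partial>\<mu>') = (\<integral>p. h (snd p) \<partial>\<gamma>)" unfolding \<mu>' by (rule integral_distr[OF fs(2) hb])
  have G2: "(\<lambda>x. (G x)\<^sup>2) \<in> borel_measurable borel" using G by measurable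
  have e3: "(\<integral>x. (G x)\<^sup>2 \<partial>\<mu>) = (\<integral>p. (G (fst p))\<^sup>2 \<partial>\<gamma>)"
    unfolding \<mu> by (rule integral_distr[OF fs(1) G2])
  have i1: "integrable \<gamma> (\<lambda>p. h (fst p))" "integrable \<gamma> (\<lambda>p. h (snd p))"
    by (intro int continuous_on_compose2[OF hc] continuous_intros; simp)+
  have i2: "integrable \<gamma> (\<lambda>p. (dist (fst p) (snd p))\<^sup>2)" by (intro int continuous_intros)
  have i3: "integrable \<gamma> (\<lambda>p. (G (fst p))\<^sup>2)"
  proof (rule integrable_const_bound)
    show "AE p in \<gamma>. norm ((G (fst p))\<^sup>2) \<le> K\<^sup>2"
      using Gle by (auto intro!: AE_I2 power_mono simp: G_def)
    show "(\<lambda>p. (G (fst p))\<^sup>2) \<in> borel_measurable \<gamma>"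
      using measurable_compose[OF fs(1) G2] .
  qed
  have pw: "h x - h y \<le> (a / 2 + (K / r)\<^sup>2 / (2 * a)) * (dist x y)\<^sup>2 + (G x)\<^sup>2 / (2 * a)" for x y
  proof (cases "x = y")
    case True
    then show ?thesis using a by simp
  next
    case xy: False
    then have d: "0 < dist x y" by simp
    show ?thesis
    proof (cases "dist x y < r")
      case True
      have "ennreal (max (h x - h y) 0 / dist x y) \<le> local_slope h r x"
        unfolding local_slope_def using True xy by (intro SUP_upper) auto
      moreover have "local_slope h r x < \<top>"
        using local_slope_le_lipschitz[OF K] by (rule le_less_trans) simp
      ultimately have "max (h x - h y) 0 / dist x y \<le> G x"
        unfolding G_def using d enn2real_mono[of "ennreal (max (h x - h y) 0 / dist x y)" "local_slope h r x"]
        by simp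
      then have "h x - h y \<le> G x * dist x y" using d by (simp add: divide_le_eq)
      also have "\<dots> \<le> a / 2 * (dist x y)\<^sup>2 + (G x)\<^sup>2 / (2 * a)"
        by (rule mult_le_weighted_squares[OF a])
      also have "\<dots> \<le> (a / 2 + (K / r)\<^sup>2 / (2 * a)) * (dist x y)\<^sup>2 + (G x)\<^sup>2 / (2 * a)"
        using a by (intro add_right_mono mult_right_mono) auto
      finally show ?thesis .
    next
      case False
      have "h x - h y \<le> K * dist x y"
        using lipschitz_onD[OF K, of x y] by (simp add: dist_real_def)
      also have "\<dots> \<le> a / 2 * (dist x y)\<^sup>2 + K\<^sup>2 / (2 * a)"
        by (rule mult_le_weighted_squares[OF a])
      \<comment> \<open>Chebyshev's argument pointwise: as \<open>dist x y\<close> is at least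
        \<open>r\<close>, the constant is absorbed into a multiple of the squared distance.\<close>
      also have "K\<^sup>2 / (2 * a) \<le> (K / r * dist x y)\<^sup>2 / (2 * a)"
      proof -
        have "K * r \<le> K * dist x y" using False K0 by (intro mult_left_mono) auto
        then have "K \<le> K / r * dist x y" using r by (simp add: field_simps)
        then show ?thesis using K0 a by (intro divide_right_mono power_mono) auto
      qed
      also have "(K / r * dist x y)\<^sup>2 / (2 * a) = (K / r)\<^sup>2 / (2 * a) * (dist x y)\<^sup>2"
        by (subst power_mult_distrib) (rule times_divide_eq_left[symmetric])
      finally have "h x - h y \<le> (a / 2 + (K / r)\<^sup>2 / (2 * a)) * (dist x y)\<^sup>2"
        by (simp add: distrib_right)
      then show ?thesis using a by (simp add: add_increasing2)
    qed
  qed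
  have "(\<integral>x. h x \<partial>\<mu>) - (\<integral>x. h x \<partial>\<mu>') = (\<integral>p. h (fst p) - h (snd p) \<partial>\<gamma>)"
    unfolding e1 e2 using i1 by simp
  also have "\<dots> \<le> (\<integral>p. (a / 2 + (K / r)\<^sup>2 / (2 * a)) * (dist (fst p) (snd p))\<^sup>2
      + (G (fst p))\<^sup>2 / (2 * a) \<partial>\<gamma>)"
    using i1 i2 i3 pw by (intro integral_mono) auto
  also have "\<dots> = (a / 2 + (K / r)\<^sup>2 / (2 * a)) * (\<integral>p. (dist (fst p) (snd p))\<^sup>2 \<partial>\<gamma>) +
      (\<integral>p. (G (fst p))\<^sup>2 \<partial>\<gamma>) / (2 * a)"
    using i2 i3 by simp
  finally show ?thesis using e3 by (simp add: G_def)
qed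

lemma W2_increment_le:
  fixes h :: "'a::metric_space \<Rightarrow> real"
  assumes "compact (UNIV :: 'a set)" and "\<mu> \<in> P2" "\<mu>' \<in> P2"
    and "K-lipschitz_on UNIV h" and "0 < r" and "0 < a"
  shows "(\<integral>x. h x \<partial>\<mu>) - (\<integral>x. h x \<partial>\<mu>') \<le>
    (a / 2 + (K / r)\<^sup>2 / (2 * a)) * (W2 \<mu> \<mu>')\<^sup>2 +
    (\<integral>x. (enn2real (local_slope h r x))\<^sup>2 \<partial>\<mu>) / (2 * a)"
  using assms by (intro le_W2_affine coupling_increment_le) (auto intro: add_pos_nonneg)

text \<open>A decreasing sequence converges to its infimum, and squaring commutes with the
  limit.\<close>

lemma INF_power2_le:
  fixes f :: "nat \<Rightarrow> ennreal"
  assumes dec: "decseq f" and fin: "(INF n. f n) < \<top>"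
  shows "(INF n. (f n)\<^sup>2) \<le> (INF n. f n)\<^sup>2"
proof -
  define l where "l = (INF n. f n)"
  have "f \<longlonglongrightarrow> l" unfolding l_def using dec by (rule LIMSEQ_INF)
  then have lim: "(\<lambda>n. f n * f n) \<longlonglongrightarrow> l * l"
    using fin by (intro tendsto_mult_ennreal) (auto simp: l_def[symmetric])
  have "(INF n. f n * f n) \<le> l * l"
    by (rule tendsto_lowerbound[OF lim always_eventually]) (auto intro: INF_lower[where f = "\<lambda>n. f n * f n"])
  then show ?thesis by (simp only: power2_eq_square l_def)
qed

text \<open>The passage \<open>r \<rightarrow> 0\<close>: the local slopes of \<open>h\<close>
  decrease to its descending slope, monotone convergence carries the bound over, and the chain rule
  compares the limit with the integrand of \<open>I_functional\<close>.\<close>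

lemma le_I_functional_if_le_local_slope:
  fixes \<nu> :: "'a::metric_space measure" and \<rho> :: "'a \<Rightarrow> real"
  assumes comp: "compact (UNIV :: 'a set)" and "prob_space \<nu>" and sets: "sets \<nu> = sets borel"
    and cvx: "convex_on {0..} U" and U: "C2_on_positive U"
    and pos: "\<And>x. 0 < \<rho> x" and L: "L-lipschitz_on UNIV \<rho>"
    and \<mu>: "\<mu> = density \<nu> (\<lambda>x. ennreal (\<rho> x))" "prob_space \<mu>"
    and K: "K-lipschitz_on UNIV (\<lambda>x. deriv U (\<rho> x))"
    and le: "\<And>r. 0 < r \<Longrightarrow> c \<le> (\<integral>x. (enn2real (local_slope (\<lambda>x. deriv U (\<rho> x)) r x))\<^sup>2 \<partial>\<mu>)"
  shows "c \<le> enn2real (I_functional U \<nu> \<rho>)"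
proof -
  interpret mu: prob_space \<mu> by fact
  let ?h = "\<lambda>x. deriv U (\<rho> x)"
  let ?r = "\<lambda>n. inverse (real (Suc n))"
  let ?s = "\<lambda>n x. local_slope ?h (?r n) x"
  have s': "sets \<mu> = sets borel" using sets \<mu> by simp
  have K0: "0 \<le> K" using K by (rule lipschitz_on_nonneg)
  have sK: "local_slope ?h r x \<le> ennreal K" for r x by (rule local_slope_le_lipschitz[OF K])
  have sfin: "local_slope ?h r x < \<top>" for r x using sK by (rule le_less_trans) simp
  have sb: "local_slope ?h r \<in> borel_measurable borel" for r
    by (rule borel_measurable_local_slope[OF lipschitz_on_continuous_on[OF K]])
  then have sm: "local_slope ?h r \<in> borel_measurable \<mu>" for r
    using s' by (simp cong: measurable_cong_sets)
  have sm'[measurable]: "local_slope ?h r \<in> borel_measurable \<nu>" for r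
    using sb[of r] sets by (simp cong: measurable_cong_sets)
  have \<rho>m: "\<rho> \<in> borel_measurable \<nu>"
    using borel_measurable_continuous_onI[OF lipschitz_on_continuous_on[OF L]] sets
    by (simp cong: measurable_cong_sets)
  have nn: "ennreal (\<integral>x. (enn2real (local_slope ?h r x))\<^sup>2 \<partial>\<mu>) = (\<integral>\<^sup>+x. (local_slope ?h r x)\<^sup>2 \<partial>\<mu>)" for r
  proof -
    have "integrable \<mu> (\<lambda>x. (enn2real (local_slope ?h r x))\<^sup>2)"
    proof (rule mu.integrable_const_bound)
      show "AE x in \<mu>. norm ((enn2real (local_slope ?h r x))\<^sup>2) \<le> K\<^sup>2"
        using sK K0 by (auto intro!: AE_I2 power_mono enn2real_leI)
      show "(\<lambda>x. (enn2real (local_slope ?h r x))\<^sup>2) \<in> borel_measurable \<mu>" using sm by measurable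
    qed
    then have "ennreal (\<integral>x. (enn2real (local_slope ?h r x))\<^sup>2 \<partial>\<mu>)
        = (\<integral>\<^sup>+x. ennreal ((enn2real (local_slope ?h r x))\<^sup>2) \<partial>\<mu>)"
      by (intro nn_integral_eq_integral[symmetric]) auto
    also have "\<dots> = (\<integral>\<^sup>+x. (local_slope ?h r x)\<^sup>2 \<partial>\<mu>)"
      using sfin by (intro nn_integral_cong) (simp flip: ennreal_power)
    finally show ?thesis .
  qed
  have "ennreal c \<le> (\<integral>\<^sup>+x. (?s n x)\<^sup>2 \<partial>\<mu>)" for n
    unfolding nn[symmetric] by (intro ennreal_leI le) simp
  then have "ennreal c \<le> (INF n. \<integral>\<^sup>+x. (?s n x)\<^sup>2 \<partial>\<mu>)" by (rule INF_greatest)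
  also have "\<dots> = (\<integral>\<^sup>+x. (INF n. (?s n x)\<^sup>2) \<partial>\<mu>)"
  proof (rule nn_integral_monotone_convergence_INF_decseq[symmetric])
    show "decseq (\<lambda>n x. (?s n x)\<^sup>2)"
      by (intro antimonoI le_funI power_mono le_funD[OF antimonoD[OF decseq_local_slope]]) auto
    show "(\<lambda>x. (?s n x)\<^sup>2) \<in> borel_measurable \<mu>" for n using sm by measurable
    \<comment> \<open>Convergence from above requires one finite integral; the Lipschitz bound
      supplies it.\<close>
    show "(\<integral>\<^sup>+x. (?s 0 x)\<^sup>2 \<partial>\<mu>) < \<infinity>" unfolding nn[symmetric] by simp
  qed
  also have "\<dots> = (\<integral>\<^sup>+x. ennreal (\<rho> x) * (INF n. (?s n x)\<^sup>2) \<partial>\<nu>)"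
    unfolding \<mu>(1) by (intro nn_integral_density) (use \<rho>m in measurable)
  also have "\<dots> \<le> I_functional U \<nu> \<rho>"
    unfolding I_functional_def
  proof (rule nn_integral_mono)
    fix x
    have D: "(deriv U has_real_derivative deriv (deriv U) (\<rho> x)) (at (\<rho> x))"
      using U pos[of x] by (auto simp: C2_on_positive_def DERIV_deriv_iff_real_differentiable)
    have "(INF n. ?s n x) \<le> ennreal (deriv (deriv U) (\<rho> x)) * descending_slope \<rho> x"
      unfolding descending_slope_eq_INF_local_slope[symmetric]
      using convex_on_deriv_mono[OF cvx] U
      by (intro descending_slope_comp_le[OF _ D pos L]) (auto simp: C2_on_positive_def)
    moreover have "(INF n. (?s n x)\<^sup>2) \<le> (INF n. ?s n x)\<^sup>2"
    proof (rule INF_power2_le)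
      show "decseq (\<lambda>n. ?s n x)"
        by (intro antimonoI le_funD[OF antimonoD[OF decseq_local_slope]])
      show "(INF n. ?s n x) < \<top>"
        by (rule le_less_trans[OF INF_lower[OF UNIV_I, of _ 0] sfin])
    qed
    ultimately have "(INF n. (?s n x)\<^sup>2) \<le> (ennreal (deriv (deriv U) (\<rho> x)) * descending_slope \<rho> x)\<^sup>2"
      by (meson order_trans power_mono zero_le)
    \<comment> \<open>\<open>ennreal\<close> sends negative numbers to 0, so in the negative case
      the left side is 0.\<close>
    also have "\<dots> \<le> ennreal ((deriv (deriv U) (\<rho> x))\<^sup>2) * (descending_slope \<rho> x)\<^sup>2"
    proof (cases "0 \<le> deriv (deriv U) (\<rho> x)")
      case True
      then show ?thesis by (simp add: power_mult_distrib ennreal_power)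
    qed (simp add: ennreal_neg)
    finally show "ennreal (\<rho> x) * (INF n. (?s n x)\<^sup>2)
      \<le> ennreal (\<rho> x * (deriv (deriv U) (\<rho> x))\<^sup>2) * (descending_slope \<rho> x)\<^sup>2"
      using pos[of x] by (simp add: ennreal_mult mult.assoc mult_left_mono)
  qed
  finally have "ennreal c \<le> I_functional U \<nu> \<rho>" .
  moreover have "I_functional U \<nu> \<rho> < \<infinity>"
    using comp assms(2) U pos L by (rule I_functional_finite)
  ultimately have "enn2real (ennreal c) \<le> enn2real (I_functional U \<nu> \<rho>)"
    by (intro enn2real_mono) auto
  \<comment> \<open>A negative \<open>c\<close> is lost under \<open>ennreal\<close>, but then the
    claim is trivial.\<close>
  then show ?thesis
    by (cases "0 \<le> c") (auto intro: order_trans[OF _ enn2real_nonneg])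
qed

text \<open>The weight \<open>b\<close> and the scale \<open>r\<close> stay fixed while
  \<open>t \<rightarrow> 0\<close>; then \<open>r \<rightarrow> 0\<close> for fixed
  \<open>b\<close>, and \<open>b\<close> is optimized last.\<close>

lemma U_functional_gap_le:
  fixes \<nu> :: "'a::metric_space measure" and \<rho> :: "'a \<Rightarrow> real"
  assumes comp: "compact (UNIV :: 'a set)" and nu: "prob_space \<nu>" and sets: "sets \<nu> = sets borel"
    and Uc: "continuous_on {0..} U" and cvx: "convex_on {0..} U"
    and geo: "wasserstein_geodesic m" and m1: "m 1 = \<nu>"
    and conv: "\<forall>t\<in>{0..1}. U_functional U \<nu> (m t) \<le>
           ereal t * U_functional U \<nu> (m 1) + ereal (1 - t) * U_functional U \<nu> (m 0)
             - ereal (1 / 2 * lam * t * (1 - t) * (W2 (m 0) (m 1))\<^sup>2)"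
    and U: "C2_on_positive U" and dens: "m 0 = density \<nu> (\<lambda>x. ennreal (\<rho> x))"
    and pos: "\<And>x. 0 < \<rho> x" and L: "L-lipschitz_on UNIV \<rho>"
    and ac: "\<forall>t\<in>{0..1}. m t \<in> P2_ac \<nu>"
  shows "U_functional U \<nu> (m 0) - U_functional U \<nu> \<nu> \<le>
    ereal (W2 (m 0) \<nu> * sqrt (enn2real (I_functional U \<nu> \<rho>)) - lam / 2 * (W2 (m 0) \<nu>)\<^sup>2)"
proof -
  let ?h = "\<lambda>x. deriv U (\<rho> x)"
  let ?w = "W2 (m 0) \<nu>"
  let ?I = "enn2real (I_functional U \<nu> \<rho>)"
  have P: "m t \<in> P2" if "t \<in> {0..1}" for t using geo that by (auto simp: wasserstein_geodesic_def)
  have prob: "prob_space (m t)" "sets (m t) = sets borel" "absolutely_continuous \<nu> (m t)"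
    if "t \<in> {0..1}" for t
    using P[OF that] ac that by (auto simp: P2_def P2_ac_def)
  obtain K where K: "K-lipschitz_on UNIV ?h"
    using deriv_comp_lipschitz[OF comp U pos L] by blast
  have diff: "\<And>r. 0 < r \<Longrightarrow> U differentiable at r" using U by (auto simp: C2_on_positive_def)
  have tangent: thesis
    if "\<And>u. U_functional U \<nu> (m 0) = ereal u \<Longrightarrow>
      ereal (u - ((\<integral>x. ?h x \<partial>(m 0)) - (\<integral>x. ?h x \<partial>(m t)))) \<le> U_functional U \<nu> (m t) \<Longrightarrow> thesis"
      "t \<in> {0..1}" for t thesis
    by (rule U_functional_tangent[OF comp nu sets Uc cvx diff lipschitz_on_continuous_on[OF L] pos
        lipschitz_on_continuous_on[OF K] dens, of "m t"]) (use that prob in auto)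
  obtain u where u: "U_functional U \<nu> (m 0) = ereal u" using tangent[of 0] by auto
  define c where "c = u - U 1 + lam / 2 * ?w\<^sup>2"
  define J where "J r = (\<integral>x. (enn2real (local_slope ?h r x))\<^sup>2 \<partial>(m 0))" for r
  have step: "u - U 1 + lam / 2 * (1 - t) * ?w\<^sup>2 \<le>
      (b / 2 + t\<^sup>2 * ((K / r)\<^sup>2 / (2 * b))) * ?w\<^sup>2 + J r / (2 * b)"
    if t: "0 < t" "t \<le> 1" and b: "0 < b" and r: "0 < r" for t b r
  proof -
    have t01: "t \<in> {0..1}" using t by auto
    let ?e = "(\<integral>x. ?h x \<partial>(m 0)) - (\<integral>x. ?h x \<partial>(m t))"
    have "ereal (u - ?e) \<le> U_functional U \<nu> (m t)"
      using tangent[OF _ t01] u by auto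
    also note conv[rule_format, OF t01]
    finally have "u - ?e \<le> t * U 1 + (1 - t) * u - 1 / 2 * lam * t * (1 - t) * ?w\<^sup>2"
      by (simp add: u m1 U_functional_self[OF nu sets])
    then have "t * (u - U 1 + lam / 2 * (1 - t) * ?w\<^sup>2) \<le> ?e" by (simp add: algebra_simps)
    \<comment> \<open>The weight \<open>b / t\<close> balances the orders: as the distance to
      \<open>m t\<close> is \<open>t * ?w\<close>, both main terms are linear in \<open>t\<close>,
      whereas the long-distance term is cubic.\<close>
    also have "?e \<le> (b / t / 2 + (K / r)\<^sup>2 / (2 * (b / t))) * (W2 (m 0) (m t))\<^sup>2 + J r / (2 * (b / t))"
      unfolding J_def using P t01 t b r by (intro W2_increment_le[OF comp _ _ K]) auto
    also have "W2 (m 0) (m t) = t * ?w"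
      using geo t m1 by (auto simp: wasserstein_geodesic_def dest!: bspec[where x = t] bspec[where x = 0])
    also have "(b / t / 2 + (K / r)\<^sup>2 / (2 * (b / t))) * (t * ?w)\<^sup>2 + J r / (2 * (b / t))
      = t * ((b / 2 + t\<^sup>2 * ((K / r)\<^sup>2 / (2 * b))) * ?w\<^sup>2 + J r / (2 * b))"
      using t b r by (simp add: field_simps power2_eq_square)
    finally show ?thesis using t by simp
  qed
  \<comment> \<open>Letting \<open>t \<rightarrow> 0\<close> removes the term with
    \<open>K / r\<close>, the only one that would blow up as
    \<open>r \<rightarrow> 0\<close>.\<close>
  have lim: "c \<le> b / 2 * ?w\<^sup>2 + J r / (2 * b)" if b: "0 < b" and r: "0 < r" for b r
  proof -
    have "((\<lambda>t. u - U 1 + lam / 2 * (1 - t) * ?w\<^sup>2) \<longlongrightarrow> u - U 1 + lam / 2 * (1 - 0) * ?w\<^sup>2) (at_right 0)"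
      by (intro tendsto_intros)
    moreover have "((\<lambda>t. (b / 2 + t\<^sup>2 * ((K / r)\<^sup>2 / (2 * b))) * ?w\<^sup>2 + J r / (2 * b)) \<longlongrightarrow>
        (b / 2 + 0\<^sup>2 * ((K / r)\<^sup>2 / (2 * b))) * ?w\<^sup>2 + J r / (2 * b)) (at_right 0)"
      by (intro tendsto_intros)
    moreover have "\<forall>\<^sub>F t in at_right (0::real). t \<in> {0<..<1}"
      by (rule eventually_at_right_real) simp
    then have "\<forall>\<^sub>F t in at_right 0. u - U 1 + lam / 2 * (1 - t) * ?w\<^sup>2 \<le>
        (b / 2 + t\<^sup>2 * ((K / r)\<^sup>2 / (2 * b))) * ?w\<^sup>2 + J r / (2 * b)"
      by (rule eventually_mono) (use step b r in auto)
    ultimately have "u - U 1 + lam / 2 * (1 - 0) * ?w\<^sup>2 \<le>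
        (b / 2 + 0\<^sup>2 * ((K / r)\<^sup>2 / (2 * b))) * ?w\<^sup>2 + J r / (2 * b)"
      by (intro tendsto_le[OF trivial_limit_at_right_real])
    then show ?thesis by (simp add: c_def)
  qed
  have "c \<le> ?w * sqrt ?I"
  proof (rule le_mult_if_le_weighted_squares)
    have "m 0 \<in> P2" "\<nu> \<in> P2" using P[of 0] P[of 1] m1 by auto
    then show "0 \<le> ?w"
      using couplings_nonempty[OF comp] unfolding W2_def
      by (intro real_sqrt_ge_zero cINF_greatest integral_nonneg_AE) auto
    fix b :: real assume b: "0 < b"
    \<comment> \<open>Solved for \<open>J r\<close>, the bound has a left side independent of
      \<open>r\<close>, as the passage \<open>r \<rightarrow> 0\<close> requires.\<close>
    have "2 * b * (c - b / 2 * ?w\<^sup>2) \<le> ?I"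
    proof (rule le_I_functional_if_le_local_slope[OF comp nu sets cvx U pos L dens prob(1) K])
      show "2 * b * (c - b / 2 * ?w\<^sup>2) \<le> (\<integral>x. (enn2real (local_slope ?h r x))\<^sup>2 \<partial>(m 0))" if "0 < r" for r
        using lim[OF b that] b by (simp add: J_def field_simps)
    qed simp
    then show "c \<le> (b * ?w\<^sup>2 + (sqrt ?I)\<^sup>2 / b) / 2"
      using b by (simp add: field_simps)
  qed simp
  then show ?thesis
    by (simp add: u U_functional_self[OF nu sets] c_def)
qed

theorem proposition3p36:
  fixes \<nu> \<mu> :: "'a::metric_space measure"
    and m :: "real \<Rightarrow> 'a measure"
    and U :: "real \<Rightarrow> real"
    and lam :: real
  assumes "compact (UNIV :: 'a set)" and "length_space (UNIV :: 'a set)"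
    and "prob_space \<nu>" and "sets \<nu> = sets borel"
    and "continuous_on {0..} U" and "convex_on {0..} U" and "U 0 = 0"
    and "\<mu> \<in> P2_on \<nu>"
    and "wasserstein_geodesic m" and "m 0 = \<mu>" and "m 1 = \<nu>"
    and "\<forall>t\<in>{0..1}. U_functional U \<nu> (m t) \<le>
           ereal t * U_functional U \<nu> (m 1) + ereal (1 - t) * U_functional U \<nu> (m 0)
             - ereal (1 / 2 * lam * t * (1 - t) * (W2 (m 0) (m 1))\<^sup>2)"
  shows "ereal (lam / 2 * (W2 \<mu> \<nu>)\<^sup>2) \<le> U_functional U \<nu> \<mu> - U_functional U \<nu> \<nu> \<and>
    (\<forall>\<rho> :: 'a \<Rightarrow> real.
       C2_on_positive U \<and> \<mu> \<in> P2_ac \<nu> \<and>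
       \<mu> = density \<nu> (\<lambda>x. ennreal (\<rho> x)) \<and> (\<forall>x. 0 < \<rho> x) \<and> (\<exists>L. L-lipschitz_on UNIV \<rho>) \<and>
       U_functional U \<nu> \<mu> < \<infinity> \<and> (\<forall>t\<in>{0..1}. m t \<in> P2_ac \<nu>)
       \<longrightarrow> U_functional U \<nu> \<mu> - U_functional U \<nu> \<nu> \<le>
           ereal (W2 \<mu> \<nu> * sqrt (enn2real (I_functional U \<nu> \<rho>)) - lam / 2 * (W2 \<mu> \<nu>)\<^sup>2))"

proof (intro conjI allI impI)
  have m: "\<forall>t\<in>{0..1}. m t \<in> P2" using assms(9) by (simp add: wasserstein_geodesic_def)
  show "ereal (lam / 2 * (W2 \<mu> \<nu>)\<^sup>2) \<le> U_functional U \<nu> \<mu> - U_functional U \<nu> \<nu>"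
    using U_functional_gap_ge[OF assms(3,4,6,7) m assms(11,12)] assms(10,11) by simp
next
  fix \<rho> :: "'a \<Rightarrow> real"
  assume *: "C2_on_positive U \<and> \<mu> \<in> P2_ac \<nu> \<and>
       \<mu> = density \<nu> (\<lambda>x. ennreal (\<rho> x)) \<and> (\<forall>x. 0 < \<rho> x) \<and> (\<exists>L. L-lipschitz_on UNIV \<rho>) \<and>
       U_functional U \<nu> \<mu> < \<infinity> \<and> (\<forall>t\<in>{0..1}. m t \<in> P2_ac \<nu>)"
  then obtain L where "L-lipschitz_on UNIV \<rho>" by blast
  then show "U_functional U \<nu> \<mu> - U_functional U \<nu> \<nu> \<le>
      ereal (W2 \<mu> \<nu> * sqrt (enn2real (I_functional U \<nu> \<rho>)) - lam / 2 * (W2 \<mu> \<nu>)\<^sup>2)"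
    using U_functional_gap_le[OF assms(1,3,4,5,6,9,11,12), of \<rho> L] * assms(10) by simp
qed

end
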